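(* For any oriented Riemannian $3$-manifold $X$, the $7$-manifold $T^*X\times\mathbb{R}$ has a $G_2$-structure.
   Context: All manifolds are $C^\infty$. On $\mathbb{R}^7$ with coordinates $(x^1,\dots,x^7)$ let $$\varphi_0=dx^{123}+dx^{145}+dx^{167}+dx^{246}-dx^{257}-dx^{347}-dx^{356},\qquad dx^{ijk}=dx^i\wedge dx^j\wedge dx^k.$$ A $7$-dimensional manifold $M$ has a $G_2$-structure if there is a smooth $3$-form $\varphi\in\Omega^3(M)$ such that for each $p\in M$ the pair $(T_pM,\varphi_p)$ is isomorphic to $(T_0\mathbb{R}^7,\varphi_0)$, i.e. there is a linear isomorphism $T_0\mathbb{R}^7\to T_pM$ pulling $\varphi_p$ back to $\varphi_0$. *)

theory Defs
  imports "HOL-Analysis.Analysis"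
begin

section \<open>Smooth maps between open subsets of Euclidean spaces\<close>

text \<open>On an open set \<open>S\<close> of a Euclidean space, \<open>Ck_on k S f\<close> says that \<open>f\<close> is of class $C^k$: all
  iterated directional derivatives of order at most \<open>k\<close> exist and are continuous.\<close>

primrec Ck_on :: "nat \<Rightarrow> 'a::real_normed_vector set \<Rightarrow> ('a \<Rightarrow> 'b::real_normed_vector) \<Rightarrow> bool" where
  "Ck_on 0 S f \<longleftrightarrow> continuous_on S f"
| "Ck_on (Suc k) S f \<longleftrightarrow>
     (\<forall>x\<in>S. f differentiable (at x)) \<and> (\<forall>v. Ck_on k S (\<lambda>x. frechet_derivative f (at x) v))"

definition smooth_on :: "'a::real_normed_vector set \<Rightarrow> ('a \<Rightarrow> 'b::real_normed_vector) \<Rightarrow> bool" where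
  "smooth_on S f \<longleftrightarrow> (\<forall>k. Ck_on k S f)"

section \<open>Smooth manifolds\<close>

text \<open>A chart is a pair of its domain and its coordinate map; values of the coordinate map outside
  the domain are irrelevant. A manifold is given by its set of points and a (not necessarily
  maximal) smooth atlas, which determines both the topology and the smooth structure. The
  dimension is that of the Euclidean model space \<open>'e\<close>.\<close>

type_synonym ('a, 'e) chart = "'a set \<times> ('a \<Rightarrow> 'e)"

record ('a, 'e) manifold =
  points :: "'a set"
  atlas :: "('a, 'e) chart set"

definition is_chart :: "'a set \<Rightarrow> ('a, 'e::euclidean_space) chart \<Rightarrow> bool" where
  "is_chart P c \<longleftrightarrow> fst c \<subseteq> P \<and> inj_on (snd c) (fst c) \<and> open (snd c ` fst c)"

definition chart_inv :: "('a, 'e) chart \<Rightarrow> 'e \<Rightarrow> 'a" where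
  "chart_inv c = inv_into (fst c) (snd c)"

definition transition :: "('a, 'e) chart \<Rightarrow> ('a, 'e) chart \<Rightarrow> 'e \<Rightarrow> 'e" where
  "transition c d = snd d \<circ> chart_inv c"

definition compatible :: "('a, 'e::euclidean_space) chart \<Rightarrow> ('a, 'e) chart \<Rightarrow> bool" where
  "compatible c d \<longleftrightarrow>
     open (snd c ` (fst c \<inter> fst d)) \<and> open (snd d ` (fst c \<inter> fst d)) \<and>
     smooth_on (snd c ` (fst c \<inter> fst d)) (transition c d) \<and>
     smooth_on (snd d ` (fst c \<inter> fst d)) (transition d c)"

definition smooth_atlas :: "'a set \<Rightarrow> ('a, 'e::euclidean_space) chart set \<Rightarrow> bool" where
  "smooth_atlas P A \<longleftrightarrow>
     (\<forall>c\<in>A. is_chart P c) \<and> (\<Union>c\<in>A. fst c) = P \<and> (\<forall>c\<in>A. \<forall>d\<in>A. compatible c d)"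

definition manifold_topology :: "('a, 'e::euclidean_space) manifold \<Rightarrow> 'a topology" where
  "manifold_topology M =
     topology (\<lambda>W. W \<subseteq> points M \<and> (\<forall>c\<in>atlas M. open (snd c ` (W \<inter> fst c))))"

definition smooth_manifold :: "('a, 'e::euclidean_space) manifold \<Rightarrow> bool" where
  "smooth_manifold M \<longleftrightarrow>
     smooth_atlas (points M) (atlas M) \<and>
     Hausdorff_space (manifold_topology M) \<and> second_countable (manifold_topology M)"

definition smooth_charts :: "('a, 'e::euclidean_space) manifold \<Rightarrow> ('a, 'e) chart set" where
  \<comment> \<open>the maximal atlas\<close>
  "smooth_charts M = {c. is_chart (points M) c \<and> (\<forall>d\<in>atlas M. compatible c d)}"

definition euclidean_manifold :: "('e::euclidean_space, 'e) manifold" where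
  "euclidean_manifold = \<lparr>points = UNIV, atlas = {(UNIV, id)}\<rparr>"

definition product_manifold ::
  "('a, 'e::euclidean_space) manifold \<Rightarrow> ('b, 'f::euclidean_space) manifold
     \<Rightarrow> ('a \<times> 'b, 'e \<times> 'f) manifold" where
  "product_manifold M N =
     \<lparr>points = points M \<times> points N,
      atlas = {(fst c \<times> fst d, map_prod (snd c) (snd d)) | c d. c \<in> atlas M \<and> d \<in> atlas N}\<rparr>"

section \<open>Tangent spaces\<close>

text \<open>A tangent vector at \<open>p\<close> assigns to every chart of the atlas around \<open>p\<close> a coordinate vector,
  subject to the usual transformation law. At the charts not containing \<open>p\<close> its value is fixed to
  be 0, so that the vector space operations are the pointwise ones.\<close>

type_synonym ('a, 'e) tangent = "('a, 'e) chart \<Rightarrow> 'e"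

definition charts_at :: "('a, 'e) manifold \<Rightarrow> 'a \<Rightarrow> ('a, 'e) chart set" where
  "charts_at M p = {c \<in> atlas M. p \<in> fst c}"

definition tangent_space :: "('a, 'e::euclidean_space) manifold \<Rightarrow> 'a \<Rightarrow> ('a, 'e) tangent set" where
  "tangent_space M p =
     {v. (\<forall>c. c \<notin> charts_at M p \<longrightarrow> v c = 0) \<and>
         (\<forall>c\<in>charts_at M p. \<forall>d\<in>charts_at M p.
            v d = frechet_derivative (transition c d) (at (snd c p)) (v c))}"

definition tangent_add :: "('a, 'e::euclidean_space) tangent \<Rightarrow> ('a, 'e) tangent \<Rightarrow> ('a, 'e) tangent"
  where "tangent_add u v = (\<lambda>c. u c + v c)"

definition tangent_scale :: "real \<Rightarrow> ('a, 'e::euclidean_space) tangent \<Rightarrow> ('a, 'e) tangent"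
  where "tangent_scale r v = (\<lambda>c. r *\<^sub>R v c)"

text \<open>The tangent vector at \<open>p\<close> whose coordinate vector in the chart \<open>c\<close> is \<open>e\<close>. For a standard
  basis vector \<open>e\<close> of the model space it is the coordinate vector field of \<open>c\<close> at \<open>p\<close>.\<close>

definition coord_vector ::
  "('a, 'e::euclidean_space) manifold \<Rightarrow> ('a, 'e) chart \<Rightarrow> 'a \<Rightarrow> 'e \<Rightarrow> ('a, 'e) tangent" where
  "coord_vector M c p e =
     (\<lambda>d. if d \<in> charts_at M p then frechet_derivative (transition c d) (at (snd c p)) e else 0)"

definition linear_on_tangent ::
  "('a, 'e::euclidean_space) manifold \<Rightarrow> 'a \<Rightarrow> (('a, 'e) tangent \<Rightarrow> real) \<Rightarrow> bool" where
  "linear_on_tangent M p \<xi> \<longleftrightarrow>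
     (\<forall>u\<in>tangent_space M p. \<forall>v\<in>tangent_space M p. \<xi> (tangent_add u v) = \<xi> u + \<xi> v) \<and>
     (\<forall>r. \<forall>u\<in>tangent_space M p. \<xi> (tangent_scale r u) = r * \<xi> u)"

section \<open>The cotangent bundle\<close>

text \<open>Covectors are made \<open>extensional\<close> so that equality of HOL functions is equality of linear
  forms on the tangent space.\<close>

definition cotangent_space ::
  "('a, 'e::euclidean_space) manifold \<Rightarrow> 'a \<Rightarrow> (('a, 'e) tangent \<Rightarrow> real) set" where
  "cotangent_space M p = {\<xi> \<in> extensional (tangent_space M p). linear_on_tangent M p \<xi>}"

text \<open>A chart $x$ of the base induces the chart $(x^i, \xi_i)$, where
  $\xi_i = \xi(\partial/\partial x^i)$.\<close>

definition cotangent_chart ::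
  "('a, 'e::euclidean_space) manifold \<Rightarrow> ('a, 'e) chart
     \<Rightarrow> ('a \<times> (('a, 'e) tangent \<Rightarrow> real), 'e \<times> 'e) chart" where
  "cotangent_chart M c =
     (Sigma (fst c) (cotangent_space M),
      \<lambda>(p, \<xi>). (snd c p, \<Sum>b\<in>Basis. \<xi> (coord_vector M c p b) *\<^sub>R b))"

definition cotangent_bundle ::
  "('a, 'e::euclidean_space) manifold \<Rightarrow> ('a \<times> (('a, 'e) tangent \<Rightarrow> real), 'e \<times> 'e) manifold" where
  "cotangent_bundle M =
     \<lparr>points = Sigma (points M) (cotangent_space M),
      atlas = cotangent_chart M ` atlas M\<rparr>"

section \<open>Orientations and Riemannian metrics\<close>

text \<open>An orientation is given by a covering of the manifold by charts of its smooth structure whose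
  transition maps have positive Jacobian determinant.\<close>

definition orientation ::
  "('a, real ^ 'n) manifold \<Rightarrow> ('a, real ^ 'n) chart set \<Rightarrow> bool" where
  "orientation M Q \<longleftrightarrow>
     Q \<subseteq> smooth_charts M \<and> (\<Union>c\<in>Q. fst c) = points M \<and>
     (\<forall>c\<in>Q. \<forall>d\<in>Q. \<forall>p\<in>fst c \<inter> fst d.
        det (matrix (frechet_derivative (transition c d) (at (snd c p)))) > 0)"

definition riemannian_metric ::
  "('a, 'e::euclidean_space) manifold \<Rightarrow> ('a \<Rightarrow> ('a, 'e) tangent \<Rightarrow> ('a, 'e) tangent \<Rightarrow> real) \<Rightarrow> bool"
  where
  "riemannian_metric M g \<longleftrightarrow>
     (\<forall>p\<in>points M.
        (\<forall>v\<in>tangent_space M p. linear_on_tangent M p (g p v)) \<and>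
        (\<forall>u\<in>tangent_space M p. \<forall>v\<in>tangent_space M p. g p u v = g p v u) \<and>
        (\<forall>v\<in>tangent_space M p. v \<noteq> (\<lambda>_. 0) \<longrightarrow> g p v v > 0)) \<and>
     (\<forall>c\<in>atlas M. \<forall>a b. smooth_on (snd c ` fst c)
        (\<lambda>x. let p = chart_inv c x in g p (coord_vector M c p a) (coord_vector M c p b)))"

section \<open>Three-forms and $G_2$-structures\<close>

definition three_form ::
  "('a, 'e::euclidean_space) manifold
     \<Rightarrow> ('a \<Rightarrow> ('a, 'e) tangent \<Rightarrow> ('a, 'e) tangent \<Rightarrow> ('a, 'e) tangent \<Rightarrow> real) \<Rightarrow> bool" where
  "three_form M \<omega> \<longleftrightarrow>
     (\<forall>p\<in>points M. \<forall>u\<in>tangent_space M p. \<forall>v\<in>tangent_space M p.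
        linear_on_tangent M p (\<lambda>w. \<omega> p w u v) \<and>
        linear_on_tangent M p (\<lambda>w. \<omega> p u w v) \<and>
        linear_on_tangent M p (\<lambda>w. \<omega> p u v w) \<and>
        \<omega> p u u v = 0 \<and> \<omega> p u v u = 0 \<and> \<omega> p v u u = 0) \<and>
     (\<forall>c\<in>atlas M. \<forall>a b e. smooth_on (snd c ` fst c)
        (\<lambda>x. let p = chart_inv c x
             in \<omega> p (coord_vector M c p a) (coord_vector M c p b) (coord_vector M c p e)))"

text \<open>$dx^i \wedge dx^j \wedge dx^k$, with the determinant convention for the wedge product. The
  index 7 of type \<open>7\<close> is the class of 0, so that \<open>1, \<dots>, 7\<close> are the seven distinct indices.\<close>

definition dx3 :: "7 \<Rightarrow> 7 \<Rightarrow> 7 \<Rightarrow> real ^ 7 \<Rightarrow> real ^ 7 \<Rightarrow> real ^ 7 \<Rightarrow> real" where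
  "dx3 i j k u v w =
     det (vector [vector [u $ i, v $ i, w $ i],
                  vector [u $ j, v $ j, w $ j],
                  vector [u $ k, v $ k, w $ k]] :: real ^ 3 ^ 3)"

definition phi0 :: "real ^ 7 \<Rightarrow> real ^ 7 \<Rightarrow> real ^ 7 \<Rightarrow> real" where
  "phi0 u v w =
     dx3 1 2 3 u v w + dx3 1 4 5 u v w + dx3 1 6 7 u v w + dx3 2 4 6 u v w
     - dx3 2 5 7 u v w - dx3 3 4 7 u v w - dx3 3 5 6 u v w"

definition tangent_iso ::
  "('a, 'e::euclidean_space) manifold \<Rightarrow> 'a \<Rightarrow> (real ^ 7 \<Rightarrow> ('a, 'e) tangent) \<Rightarrow> bool" where
  "tangent_iso M p L \<longleftrightarrow>
     bij_betw L UNIV (tangent_space M p) \<and>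
     (\<forall>u v. L (u + v) = tangent_add (L u) (L v)) \<and>
     (\<forall>r u. L (r *\<^sub>R u) = tangent_scale r (L u))"

definition has_G2_structure :: "('a, 'e::euclidean_space) manifold \<Rightarrow> bool" where
  "has_G2_structure M \<longleftrightarrow>
     smooth_manifold M \<and> DIM('e) = 7 \<and>
     (\<exists>\<phi>. three_form M \<phi> \<and>
        (\<forall>p\<in>points M. \<exists>L. tangent_iso M p L \<and>
           (\<forall>u v w. \<phi> p (L u) (L v) (L w) = phi0 u v w)))"

end

theory Submission
  imports Defs
begin

text \<open>The metric gives $T^*X$ a Levi-Civita connection, which splits the tangent space of
  $T^*X \times \mathbb{R}$ at a point over $p$ as $T_pX \oplus T^*_pX \oplus \mathbb{R}
  \cong (T_pX \otimes \mathbb{C}) \oplus \mathbb{R}$. The orientation of $X$ turns $T_pX \otimes \mathbb{C}$ into an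
  $SU(3)$-space with fundamental 2-form $\omega$ and complex volume form $\Omega$, and
  $dt \wedge \omega + \mathrm{Re}\,\Omega$ becomes $\varphi_0$ in a basis adapted to an oriented
  orthonormal frame of $T_pX$.

  No vector bundles or covariant derivatives are needed: the splitting is written down in each chart
  by means of the Christoffel symbols, and the classical transformation law of these symbols, in
  which the second derivatives of the coordinate change cancel those appearing in the coordinate
  change of $T(T^*X)$, shows that the result does not depend on the chart.\<close>

section \<open>Smooth maps\<close>

text \<open>Put t = x^1, z^1 = x^2 + i x^3, z^2 = x^4 + i x^5 and z^3 = x^6 + i x^7. Then \<phi>_0 =
  dt \<and> (dx^23 + dx^45 + dx^67) + Re (dz^1 \<and> dz^2 \<and> dz^3), which is where the form
  comes from. The metric determines \<omega>, but a change of orthonormal frame multiplies \<Omega>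
  by its determinant, so the metric fixes \<Omega> only up to sign and the orientation has to choose
  the sign. The charts of the total space come from all charts of the atlas of X, and these need not
  be oriented; the charts of \<open>Q\<close> lie only in the maximal atlas. Hence \<Omega> carries
  in each chart a signed density, the sign being read off from a nearby chart of \<open>Q\<close>.
  The algebra rests on one covariance property, \<open>g2_form_frame\<close>. With a Jacobian as the
  matrix it gives independence of the chart, with an oriented orthonormal frame it gives the
  comparison with \<phi>_0. Covectors are compared through their pairings with vectors, which keeps
  inverse Jacobians out of the second-order computations.\<close>

lemma Ck_on_imp_continuous_on: "Ck_on k S f \<Longrightarrow> continuous_on S f"
proof (cases k)
  case (Suc j)
  assume "Ck_on k S f"
  then show ?thesis
    using Suc by (auto intro!: continuous_at_imp_continuous_on differentiable_imp_continuous_within)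
qed auto

lemma Ck_on_SucD: "Ck_on (Suc k) S f \<Longrightarrow> Ck_on k S f"
proof (induction k arbitrary: f)
  case 0
  then show ?case using Ck_on_imp_continuous_on[OF 0] by simp
next
  case (Suc k)
  then show ?case by (metis Ck_on.simps(2))
qed

lemma Ck_on_subset: "Ck_on k S f \<Longrightarrow> T \<subseteq> S \<Longrightarrow> Ck_on k T f"
  by (induction k arbitrary: f) (auto intro: continuous_on_subset)

lemma Ck_on_cong:
  assumes "open S" "\<And>x. x \<in> S \<Longrightarrow> f x = g x" "Ck_on k S f"
  shows "Ck_on k S g"
  using assms(2,3)
proof (induction k arbitrary: f g)
  case 0
  then show ?case using continuous_on_eq by auto
next
  case (Suc k)
  have d: "f differentiable (at x)" if "x \<in> S" for x
    using Suc.prems that by auto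
  have "(g has_derivative frechet_derivative f (at x)) (at x)" if "x \<in> S" for x
    using has_derivative_transform_within_open[OF d[OF that, unfolded frechet_derivative_works] assms(1) that]
      Suc.prems(1) by auto
  then have "g differentiable (at x)" "frechet_derivative f (at x) = frechet_derivative g (at x)" if "x \<in> S" for x
    using that frechet_derivative_at differentiable_def by blast+
  moreover have "Ck_on k S (\<lambda>x. frechet_derivative g (at x) v)" for v
    by (rule Suc.IH[of "\<lambda>x. frechet_derivative f (at x) v"]) (use Suc.prems calculation in auto)
  ultimately show ?case by auto
qed

text \<open>Derivatives are taken \<open>at x\<close> without restriction to a set, so the
  neighbourhood that works for \<open>f\<close> at order \<open>Suc k\<close> works for its
  directional derivatives at order \<open>k\<close>. This serves functions with smooth formulas that
  are only local, such as \<open>volume_density\<close>.\<close>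

lemma Ck_on_local:
  assumes "\<And>x. x \<in> S \<Longrightarrow> \<exists>T. open T \<and> x \<in> T \<and> Ck_on k T f"
  shows "Ck_on k S f"
  using assms
proof (induction k arbitrary: f)
  case 0
  have "isCont f x" if "x \<in> S" for x
    using 0[OF that] by (auto simp: continuous_on_eq_continuous_at)
  then show ?case by (simp add: continuous_at_imp_continuous_on)
next
  case (Suc k)
  have "Ck_on k S (\<lambda>x. frechet_derivative f (at x) v)" for v
  proof (rule Suc.IH)
    show "\<exists>T. open T \<and> x \<in> T \<and> Ck_on k T (\<lambda>x. frechet_derivative f (at x) v)" if "x \<in> S" for x
      using Suc.prems[OF that] by auto
  qed
  then show ?case using Suc.prems by fastforce
qed

lemma Ck_on_const: "Ck_on k S (\<lambda>_. c)"
  by (induction k arbitrary: c) auto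

lemma Ck_on_bounded_linear:
  assumes "bounded_linear L" "Ck_on k S f" "open S"
  shows "Ck_on k S (\<lambda>x. L (f x))"
  using assms(2)
proof (induction k arbitrary: f)
  case 0
  then show ?case using assms(1) by (simp add: bounded_linear.continuous_on)
next
  case (Suc k)
  have "((\<lambda>x. L (f x)) has_derivative (\<lambda>v. L (frechet_derivative f (at x) v))) (at x)" if "x \<in> S" for x
    using bounded_linear.has_derivative[OF assms(1)] Suc.prems that by (auto simp: frechet_derivative_works)
  then have *: "(\<lambda>x. L (f x)) differentiable (at x)"
    "(\<lambda>v. L (frechet_derivative f (at x) v)) = frechet_derivative (\<lambda>x. L (f x)) (at x)" if "x \<in> S" for x
    using that frechet_derivative_at differentiable_def by blast+
  moreover have "Ck_on k S (\<lambda>x. frechet_derivative (\<lambda>x. L (f x)) (at x) v)" for v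
    by (rule Ck_on_cong[OF assms(3) _ Suc.IH[of "\<lambda>x. frechet_derivative f (at x) v"]])
      (use Suc.prems *(2) in \<open>auto simp: fun_eq_iff\<close>)
  ultimately show ?case by auto
qed

lemma Ck_on_add:
  assumes "open S" "Ck_on k S f" "Ck_on k S g"
  shows "Ck_on k S (\<lambda>x. f x + g x)"
  using assms(2,3)
proof (induction k arbitrary: f g)
  case 0
  then show ?case by (auto intro: continuous_on_add)
next
  case (Suc k)
  have "((\<lambda>x. f x + g x) has_derivative (\<lambda>v. frechet_derivative f (at x) v + frechet_derivative g (at x) v)) (at x)"
    if "x \<in> S" for x
    using Suc.prems that by (auto simp: frechet_derivative_works intro!: has_derivative_add)
  then have *: "(\<lambda>x. f x + g x) differentiable (at x)"
    "(\<lambda>v. frechet_derivative f (at x) v + frechet_derivative g (at x) v) = frechet_derivative (\<lambda>x. f x + g x) (at x)"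
    if "x \<in> S" for x
    using that frechet_derivative_at differentiable_def by blast+
  moreover have "Ck_on k S (\<lambda>x. frechet_derivative (\<lambda>x. f x + g x) (at x) v)" for v
    by (rule Ck_on_cong[OF assms(1) _ Suc.IH[of "\<lambda>x. frechet_derivative f (at x) v" "\<lambda>x. frechet_derivative g (at x) v"]])
      (use Suc.prems *(2) in \<open>auto simp: fun_eq_iff\<close>)
  ultimately show ?case by auto
qed

lemma Ck_on_sum:
  assumes "open S" "\<And>i. i \<in> I \<Longrightarrow> Ck_on k S (f i)"
  shows "Ck_on k S (\<lambda>x. \<Sum>i\<in>I. f i x)"
  using assms(2)
  by (induction I rule: infinite_finite_induct) (auto simp: Ck_on_const intro!: Ck_on_add assms(1))

text \<open>Treating an arbitrary bounded bilinear map lets one induction on the product rule cover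
  scalar multiples, products, inner products, matrix-vector products and the cross product.\<close>

lemma Ck_on_bilinear:
  assumes "bounded_bilinear B" "open S" "Ck_on k S f" "Ck_on k S g"
  shows "Ck_on k S (\<lambda>x. B (f x) (g x))"
  using assms(3,4)
proof (induction k arbitrary: f g)
  case 0
  then show ?case using assms(1) by (auto intro: bounded_bilinear.continuous_on)
next
  case (Suc k)
  have "((\<lambda>x. B (f x) (g x)) has_derivative
      (\<lambda>v. B (f x) (frechet_derivative g (at x) v) + B (frechet_derivative f (at x) v) (g x))) (at x)"
    if "x \<in> S" for x
    using Suc.prems that
    by (auto simp: frechet_derivative_works intro!: bounded_bilinear.FDERIV[OF assms(1)])
  then have *: "(\<lambda>x. B (f x) (g x)) differentiable (at x)"
    "(\<lambda>v. B (f x) (frechet_derivative g (at x) v) + B (frechet_derivative f (at x) v) (g x))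
      = frechet_derivative (\<lambda>x. B (f x) (g x)) (at x)"
    if "x \<in> S" for x
    using that frechet_derivative_at differentiable_def by blast+
  moreover have "Ck_on k S (\<lambda>x. frechet_derivative (\<lambda>x. B (f x) (g x)) (at x) v)" for v
    by (rule Ck_on_cong[OF assms(2) _ Ck_on_add[OF assms(2)
          Suc.IH[of "f" "\<lambda>x. frechet_derivative g (at x) v"]
          Suc.IH[of "\<lambda>x. frechet_derivative f (at x) v" g]]])
      (use Suc.prems *(2) Ck_on_SucD[OF Suc.prems(1)] Ck_on_SucD[OF Suc.prems(2)] in \<open>auto simp: fun_eq_iff\<close>)
  ultimately show ?case by auto
qed

lemma Ck_on_compose:
  fixes f :: "'a::euclidean_space \<Rightarrow> 'b::real_normed_vector" and g :: "'c::real_normed_vector \<Rightarrow> 'a"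
  assumes "open S" "Ck_on k T f" "Ck_on k S g" "g ` S \<subseteq> T"
  shows "Ck_on k S (\<lambda>x. f (g x))"
  using assms(2,3)
proof (induction k arbitrary: f)
  case 0
  then show ?case using assms(4) by (auto intro: continuous_on_compose2)
next
  case (Suc k)
  have gT: "g x \<in> T" if "x \<in> S" for x using assms(4) that by auto
  have "((\<lambda>x. f (g x)) has_derivative
      (\<lambda>v. frechet_derivative f (at (g x)) (frechet_derivative g (at x) v))) (at x)" if "x \<in> S" for x
    using diff_chain_at[of g "frechet_derivative g (at x)" x f "frechet_derivative f (at (g x))"]
      Suc.prems that gT by (auto simp: frechet_derivative_works o_def)
  then have *: "(\<lambda>x. f (g x)) differentiable (at x)"
    "(\<lambda>v. frechet_derivative f (at (g x)) (frechet_derivative g (at x) v)) = frechet_derivative (\<lambda>x. f (g x)) (at x)"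
    if "x \<in> S" for x
    using that frechet_derivative_at differentiable_def by blast+
  have lin: "linear (frechet_derivative f (at (g x)))" if "x \<in> S" for x
    using Suc.prems gT[OF that] linear_frechet_derivative by auto
  \<comment> \<open>In the chain rule the direction in which \<open>f\<close> is differentiated
    moves with \<open>x\<close>, whereas the induction hypothesis speaks of fixed directions.
    Expanding in a basis leaves fixed directions with variable coefficients.\<close>
  have expand: "(\<Sum>b\<in>Basis. (frechet_derivative g (at x) v \<bullet> b) *\<^sub>R frechet_derivative f (at (g x)) b)
       = frechet_derivative (\<lambda>x. f (g x)) (at x) v" if "x \<in> S" for x v
  proof -
    have "frechet_derivative f (at (g x)) (frechet_derivative g (at x) v)
       = frechet_derivative f (at (g x)) (\<Sum>b\<in>Basis. (frechet_derivative g (at x) v \<bullet> b) *\<^sub>R b)"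
      by (simp add: euclidean_representation)
    also have "\<dots> = (\<Sum>b\<in>Basis. (frechet_derivative g (at x) v \<bullet> b) *\<^sub>R frechet_derivative f (at (g x)) b)"
      by (simp add: linear_sum[OF lin[OF that]] linear_scale[OF lin[OF that]])
    finally show ?thesis using *(2)[OF that] by (simp add: fun_eq_iff)
  qed
  have g: "Ck_on k S g" using Suc.prems Ck_on_SucD by blast
  have "Ck_on k S (\<lambda>x. frechet_derivative (\<lambda>x. f (g x)) (at x) v)" for v
  proof (rule Ck_on_cong[OF assms(1) expand], assumption, intro Ck_on_sum assms(1)
      Ck_on_bilinear[OF bounded_bilinear_scaleR])
    fix b :: 'a
    show "Ck_on k S (\<lambda>x. frechet_derivative g (at x) v \<bullet> b)"
      using Suc.prems assms(1) by (auto intro!: Ck_on_bounded_linear[OF bounded_linear_inner_left])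
    show "Ck_on k S (\<lambda>x. frechet_derivative f (at (g x)) b)"
      using Suc.IH[of "\<lambda>y. frechet_derivative f (at y) b"] Suc.prems g by auto
  qed
  then show ?case using * by auto
qed

lemma smooth_on_imp_continuous_on: "smooth_on S f \<Longrightarrow> continuous_on S f"
  using Ck_on_imp_continuous_on smooth_on_def by blast

lemma smooth_on_differentiable: "smooth_on S f \<Longrightarrow> x \<in> S \<Longrightarrow> f differentiable (at x)"
  unfolding smooth_on_def by (metis Ck_on.simps(2))

lemma smooth_on_has_derivative:
  "smooth_on S f \<Longrightarrow> x \<in> S \<Longrightarrow> (f has_derivative frechet_derivative f (at x)) (at x)"
  using smooth_on_differentiable frechet_derivative_works by blast

lemma smooth_on_linear_derivative: "smooth_on S f \<Longrightarrow> x \<in> S \<Longrightarrow> linear (frechet_derivative f (at x))"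
  using smooth_on_differentiable linear_frechet_derivative by blast

lemma smooth_on_frechet_derivative: "smooth_on S f \<Longrightarrow> smooth_on S (\<lambda>x. frechet_derivative f (at x) v)"
  unfolding smooth_on_def by (metis Ck_on.simps(2))

lemma smooth_on_subset: "smooth_on S f \<Longrightarrow> T \<subseteq> S \<Longrightarrow> smooth_on T f"
  unfolding smooth_on_def using Ck_on_subset by blast

lemma smooth_on_cong:
  "open S \<Longrightarrow> smooth_on S f \<Longrightarrow> (\<And>x. x \<in> S \<Longrightarrow> f x = g x) \<Longrightarrow> smooth_on S g"
  unfolding smooth_on_def using Ck_on_cong by metis

lemma smooth_on_local:
  assumes "\<And>x. x \<in> S \<Longrightarrow> \<exists>T. open T \<and> x \<in> T \<and> smooth_on T f"
  shows "smooth_on S f"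
  unfolding smooth_on_def
proof
  show "Ck_on k S f" for k
    by (rule Ck_on_local) (use assms smooth_on_def in blast)
qed

named_theorems smooth_intros

lemma smooth_on_const [smooth_intros]: "smooth_on S (\<lambda>_. c)"
  by (simp add: smooth_on_def Ck_on_const)

lemma smooth_on_bounded_linear:
  "bounded_linear L \<Longrightarrow> open S \<Longrightarrow> smooth_on S f \<Longrightarrow> smooth_on S (\<lambda>x. L (f x))"
  by (simp add: smooth_on_def Ck_on_bounded_linear)

lemma smooth_on_ident [smooth_intros]: "smooth_on S (\<lambda>x. x)"
  unfolding smooth_on_def
proof
  show "Ck_on k S (\<lambda>x. x)" for k
    by (cases k) (auto simp: Ck_on_const)
qed

lemma smooth_on_linear:
  fixes L :: "'a::euclidean_space \<Rightarrow> 'b::real_normed_vector"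
  shows "linear L \<Longrightarrow> open S \<Longrightarrow> smooth_on S f \<Longrightarrow> smooth_on S (\<lambda>x. L (f x))"
  by (simp add: smooth_on_bounded_linear linear_conv_bounded_linear)

lemma smooth_on_bilinear:
  "bounded_bilinear B \<Longrightarrow> open S \<Longrightarrow> smooth_on S f \<Longrightarrow> smooth_on S g \<Longrightarrow> smooth_on S (\<lambda>x. B (f x) (g x))"
  by (simp add: smooth_on_def Ck_on_bilinear)

lemmas smooth_on_scaleR [smooth_intros] = smooth_on_bilinear[OF bounded_bilinear_scaleR]
lemmas smooth_on_mult [smooth_intros] = smooth_on_bilinear[OF bounded_bilinear_mult]
lemmas smooth_on_inner [smooth_intros] = smooth_on_bilinear[OF bounded_bilinear_inner]
lemmas smooth_on_fst [smooth_intros] = smooth_on_bounded_linear[OF bounded_linear_fst]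
lemmas smooth_on_snd [smooth_intros] = smooth_on_bounded_linear[OF bounded_linear_snd]
lemmas smooth_on_minus [smooth_intros] = smooth_on_bounded_linear[OF bounded_linear_minus[OF bounded_linear_ident]]
lemmas smooth_on_vec_nth = smooth_on_bounded_linear[OF bounded_linear_vec_nth]

lemma smooth_on_add [smooth_intros]:
  "open S \<Longrightarrow> smooth_on S f \<Longrightarrow> smooth_on S g \<Longrightarrow> smooth_on S (\<lambda>x. f x + g x)"
  by (simp add: smooth_on_def Ck_on_add)

lemma smooth_on_diff [smooth_intros]:
  "open S \<Longrightarrow> smooth_on S f \<Longrightarrow> smooth_on S g \<Longrightarrow> smooth_on S (\<lambda>x. f x - g x)"
  using smooth_on_add[OF _ _ smooth_on_minus, of S f g] by simp

lemma smooth_on_sum [smooth_intros]: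
  "open S \<Longrightarrow> (\<And>i. i \<in> I \<Longrightarrow> smooth_on S (f i)) \<Longrightarrow> smooth_on S (\<lambda>x. \<Sum>i\<in>I. f i x)"
  by (simp add: smooth_on_def Ck_on_sum)

lemma smooth_on_prod [smooth_intros]:
  fixes f :: "'i \<Rightarrow> 'a::real_normed_vector \<Rightarrow> real"
  shows "open S \<Longrightarrow> (\<And>i. i \<in> I \<Longrightarrow> smooth_on S (f i)) \<Longrightarrow> smooth_on S (\<lambda>x. \<Prod>i\<in>I. f i x)"
  by (induction I rule: infinite_finite_induct) (simp_all add: smooth_on_const smooth_on_mult)

lemma smooth_on_compose:
  fixes f :: "'a::euclidean_space \<Rightarrow> 'b::real_normed_vector" and g :: "'c::real_normed_vector \<Rightarrow> 'a"
  shows "smooth_on T f \<Longrightarrow> open S \<Longrightarrow> smooth_on S g \<Longrightarrow> g ` S \<subseteq> T \<Longrightarrow> smooth_on S (\<lambda>x. f (g x))"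
  unfolding smooth_on_def by (metis Ck_on_compose)

lemma smooth_on_Pair [smooth_intros]:
  assumes "open S" "smooth_on S f" "smooth_on S g"
  shows "smooth_on S (\<lambda>x. (f x, g x))"
proof -
  have "bounded_linear (\<lambda>x. (x, 0))" "bounded_linear (\<lambda>x. (0, x))"
    by (auto intro!: bounded_linear_Pair bounded_linear_ident bounded_linear_zero)
  then have "smooth_on S (\<lambda>x. (f x, 0) + (0, g x))"
    using assms by (intro smooth_on_add smooth_on_bounded_linear[where L = "\<lambda>x. (x, 0)"]
        smooth_on_bounded_linear[where L = "\<lambda>x. (0, x)"])
  then show ?thesis by simp
qed

lemma smooth_on_vec_lambda [smooth_intros]:
  fixes f :: "'n::finite \<Rightarrow> 'a::real_normed_vector \<Rightarrow> 'b::euclidean_space"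
  assumes "open S" "\<And>i. smooth_on S (f i)"
  shows "smooth_on S (\<lambda>x. \<chi> i. f i x)"
proof -
  have "linear (axis i :: 'b \<Rightarrow> 'b ^ 'n)" for i
    by (intro linearI) (auto simp: axis_def vec_eq_iff)
  then have "smooth_on S (\<lambda>x. \<Sum>i\<in>UNIV. axis i (f i x))"
    using assms by (intro smooth_on_sum smooth_on_linear[where L = "axis _"]) auto
  moreover have "(\<Sum>i\<in>UNIV. axis i (f i x)) = (\<chi> i. f i x)" for x
    by (simp add: vec_eq_iff axis_def)
  ultimately show ?thesis by simp
qed

section \<open>Reciprocals, square roots and determinants\<close>

lemma Ck_on_real_induct:
  fixes f :: "real \<Rightarrow> real"
  assumes "open S" "\<And>x. x \<in> S \<Longrightarrow> (f has_real_derivative f' x) (at x)" "Ck_on k S f'"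
  shows "Ck_on (Suc k) S f"
proof -
  have "(f has_derivative (\<lambda>v. f' x * v)) (at x)" if "x \<in> S" for x
    using assms(2)[OF that] by (simp add: has_field_derivative_def)
  then have *: "f differentiable (at x)" "(\<lambda>v. f' x * v) = frechet_derivative f (at x)" if "x \<in> S" for x
    using that frechet_derivative_at differentiable_def by blast+
  have "Ck_on k S (\<lambda>x. frechet_derivative f (at x) v)" for v
    by (rule Ck_on_cong[OF assms(1) _ Ck_on_bounded_linear[OF bounded_linear_mult_left assms(3,1)]])
      (use *(2) in \<open>auto simp: fun_eq_iff\<close>)
  then show ?thesis using * by auto
qed

text \<open>Bootstrapping: the derivative of \<open>inverse\<close> is a polynomial in
  \<open>inverse\<close>, so each order of smoothness yields the next. For \<open>sqrt\<close> the
  same works with the derivative \<open>inverse (sqrt x) / 2\<close>.\<close>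

lemma Ck_on_inverse: "Ck_on k {x::real. x \<noteq> 0} inverse"
proof (induction k)
  case 0
  then show ?case by (auto intro!: continuous_intros)
next
  case (Suc k)
  have "open {x::real. x \<noteq> 0}" by (simp add: open_Collect_neq)
  then show ?case
    by (rule Ck_on_real_induct[where f' = "\<lambda>x. - (inverse x * inverse x)"])
      (auto intro!: derivative_eq_intros Ck_on_bounded_linear[OF bounded_linear_minus[OF bounded_linear_ident]]
        Ck_on_bilinear[OF bounded_bilinear_mult] Suc.IH simp: open_Collect_neq)
qed

lemma Ck_on_sqrt: "Ck_on k {x::real. x > 0} sqrt"
proof (induction k)
  case 0
  then show ?case by (auto intro!: continuous_intros)
next
  case (Suc k)
  have o: "open {x::real. x > 0}" using open_greaterThan[of "0::real"] by (simp add: greaterThan_def)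
  have "Ck_on k {x::real. x > 0} (\<lambda>x. inverse (sqrt x))"
    by (rule Ck_on_compose[OF o Ck_on_inverse Suc.IH]) auto
  then have "Ck_on k {x::real. x > 0} (\<lambda>x. inverse (sqrt x) * (1/2))"
    by (rule Ck_on_bounded_linear[OF bounded_linear_mult_left]) (rule o)
  then show ?case
    by (rule Ck_on_real_induct[OF o, rotated]) (auto intro!: DERIV_cong[OF DERIV_real_sqrt])
qed

lemma smooth_on_inverse [smooth_intros]:
  fixes f :: "'a::real_normed_vector \<Rightarrow> real"
  assumes "open S" "smooth_on S f" "\<And>x. x \<in> S \<Longrightarrow> f x \<noteq> 0"
  shows "smooth_on S (\<lambda>x. inverse (f x))"
  by (rule smooth_on_compose[where T = "{x. x \<noteq> 0}"]) (use assms in \<open>auto simp: smooth_on_def Ck_on_inverse\<close>)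

lemma smooth_on_divide [smooth_intros]:
  fixes f g :: "'a::real_normed_vector \<Rightarrow> real"
  assumes "open S" "smooth_on S f" "smooth_on S g" "\<And>x. x \<in> S \<Longrightarrow> g x \<noteq> 0"
  shows "smooth_on S (\<lambda>x. f x / g x)"
  unfolding divide_inverse using assms by (intro smooth_intros)

lemma smooth_on_sqrt [smooth_intros]:
  fixes f :: "'a::real_normed_vector \<Rightarrow> real"
  assumes "open S" "smooth_on S f" "\<And>x. x \<in> S \<Longrightarrow> f x > 0"
  shows "smooth_on S (\<lambda>x. sqrt (f x))"
  by (rule smooth_on_compose[where T = "{x. x > 0}"]) (use assms in \<open>auto simp: smooth_on_def Ck_on_sqrt\<close>)

lemma smooth_on_det [smooth_intros]:
  fixes A :: "'a::real_normed_vector \<Rightarrow> real ^ 'n ^ 'n"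
  assumes "open S" "\<And>i j. smooth_on S (\<lambda>x. A x $ i $ j)"
  shows "smooth_on S (\<lambda>x. det (A x))"
  unfolding det_def using assms by (intro smooth_intros)

text \<open>Both the base point and the direction may move; this is what cotangent transition maps
  and Christoffel symbols require. The basis expansion is the one used for compositions.\<close>

lemma smooth_on_frechet_derivative_apply:
  fixes f :: "'a::euclidean_space \<Rightarrow> 'b::real_normed_vector" and g :: "'c::real_normed_vector \<Rightarrow> 'a"
  assumes "smooth_on T f" "open S" "smooth_on S g" "g ` S \<subseteq> T" "smooth_on S v"
  shows "smooth_on S (\<lambda>x. frechet_derivative f (at (g x)) (v x))"
proof (rule smooth_on_cong[OF assms(2)])
  show "smooth_on S (\<lambda>x. \<Sum>b\<in>Basis. (v x \<bullet> b) *\<^sub>R frechet_derivative f (at (g x)) b)"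
    using assms
    by (intro smooth_intros smooth_on_compose[OF smooth_on_frechet_derivative[OF assms(1)]])
  fix x assume "x \<in> S"
  then have l: "linear (frechet_derivative f (at (g x)))"
    using assms smooth_on_linear_derivative by blast
  have "frechet_derivative f (at (g x)) (v x) = frechet_derivative f (at (g x)) (\<Sum>b\<in>Basis. (v x \<bullet> b) *\<^sub>R b)"
    by (simp add: euclidean_representation)
  then show "(\<Sum>b\<in>Basis. (v x \<bullet> b) *\<^sub>R frechet_derivative f (at (g x)) b) = frechet_derivative f (at (g x)) (v x)"
    by (simp add: linear_sum[OF l] linear_scale[OF l])
qed


section \<open>Symmetry of second derivatives\<close>

lemma DERIV_along_line:
  fixes f :: "'a::real_normed_vector \<Rightarrow> real"
  assumes "f differentiable (at (y + s *\<^sub>R a))"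
  shows "((\<lambda>s. f (y + s *\<^sub>R a)) has_real_derivative frechet_derivative f (at (y + s *\<^sub>R a)) a) (at s)"
proof -
  have "((\<lambda>s. y + s *\<^sub>R a) has_derivative (\<lambda>v. v *\<^sub>R a)) (at s)"
    by (auto intro!: derivative_eq_intros)
  then have "((\<lambda>s. f (y + s *\<^sub>R a)) has_derivative (\<lambda>v. frechet_derivative f (at (y + s *\<^sub>R a)) (v *\<^sub>R a))) (at s)"
    using diff_chain_at[of "\<lambda>s. y + s *\<^sub>R a" "\<lambda>v. v *\<^sub>R a" s f "frechet_derivative f (at (y + s *\<^sub>R a))"] assms
    by (simp add: frechet_derivative_works o_def)
  then show ?thesis
    using linear_scale[OF linear_frechet_derivative[OF assms]]
    by (simp add: has_field_derivative_def mult_commute_abs)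
qed

text \<open>The second difference over a parallelogram is the increment, in direction
  \<open>a\<close>, of the difference in direction \<open>b\<close>. One mean value theorem in each
  direction turns it into a mixed derivative at a point of the parallelogram.\<close>

lemma second_difference_mvt:
  fixes f :: "'a::real_normed_vector \<Rightarrow> real"
  assumes "smooth_on U f" "h > 0" "\<And>s t. 0 \<le> s \<Longrightarrow> s \<le> h \<Longrightarrow> 0 \<le> t \<Longrightarrow> t \<le> h \<Longrightarrow> x + s *\<^sub>R a + t *\<^sub>R b \<in> U"
  shows "\<exists>s t. 0 \<le> s \<and> s \<le> h \<and> 0 \<le> t \<and> t \<le> h \<and>
    f (x + h *\<^sub>R a + h *\<^sub>R b) - f (x + h *\<^sub>R a) - f (x + h *\<^sub>R b) + f x
      = h * h * frechet_derivative (\<lambda>y. frechet_derivative f (at y) a) (at (x + s *\<^sub>R a + t *\<^sub>R b)) b"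
proof -
  define D where "D y = frechet_derivative f (at y) a" for y
  have D: "smooth_on U D" unfolding D_def by (rule smooth_on_frechet_derivative[OF assms(1)])
  have 1: "((\<lambda>s. f (x + s *\<^sub>R a + t *\<^sub>R b)) has_real_derivative D (x + s *\<^sub>R a + t *\<^sub>R b)) (at s)"
    if "0 \<le> s" "s \<le> h" "0 \<le> t" "t \<le> h" for s t
    using DERIV_along_line[of f "x + t *\<^sub>R b" s a] smooth_on_differentiable[OF assms(1) assms(3)[OF that]]
    by (simp add: D_def algebra_simps)
  have 2: "((\<lambda>t. D (x + s *\<^sub>R a + t *\<^sub>R b)) has_real_derivative frechet_derivative D (at (x + s *\<^sub>R a + t *\<^sub>R b)) b) (at t)"
    if "0 \<le> s" "s \<le> h" "0 \<le> t" "t \<le> h" for s t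
    using DERIV_along_line[of D "x + s *\<^sub>R a" t b] smooth_on_differentiable[OF D assms(3)[OF that]]
    by simp
  have 3: "((\<lambda>s. f (x + s *\<^sub>R a + h *\<^sub>R b) - f (x + s *\<^sub>R a)) has_real_derivative
      (D (x + s *\<^sub>R a + h *\<^sub>R b) - D (x + s *\<^sub>R a))) (at s)" if "0 \<le> s" "s \<le> h" for s
    using DERIV_diff[OF 1[OF that, of h] 1[OF that, of 0]] assms(2) by simp
  obtain s where s: "0 < s" "s < h"
    "f (x + h *\<^sub>R a + h *\<^sub>R b) - f (x + h *\<^sub>R a) - (f (x + h *\<^sub>R b) - f x) = h * (D (x + s *\<^sub>R a + h *\<^sub>R b) - D (x + s *\<^sub>R a))"
    using MVT2[OF assms(2) 3] by auto
  obtain t where t: "0 < t" "t < h"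
    "D (x + s *\<^sub>R a + h *\<^sub>R b) - D (x + s *\<^sub>R a) = h * frechet_derivative D (at (x + s *\<^sub>R a + t *\<^sub>R b)) b"
    using MVT2[OF assms(2) 2[of s]] s by auto
  have "f (x + h *\<^sub>R a + h *\<^sub>R b) - f (x + h *\<^sub>R a) - f (x + h *\<^sub>R b) + f x
      = h * h * frechet_derivative D (at (x + s *\<^sub>R a + t *\<^sub>R b)) b"
    using s(3) t(3) by simp
  then show ?thesis
    unfolding D_def using s t less_imp_le by blast
qed

text \<open>The second difference does not change when \<open>a\<close> and \<open>b\<close> are
  exchanged, so the two mixed derivatives agree at two points of an arbitrarily small parallelogram
  at \<open>x\<close>; continuity carries the equality to \<open>x\<close>.\<close>

lemma frechet_derivative_symmetric_real:
  fixes f :: "'a::real_normed_vector \<Rightarrow> real"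
  assumes "smooth_on U f" "open U" "x \<in> U"
  shows "frechet_derivative (\<lambda>y. frechet_derivative f (at y) a) (at x) b
       = frechet_derivative (\<lambda>y. frechet_derivative f (at y) b) (at x) a"
proof -
  define P where "P y = frechet_derivative (\<lambda>y. frechet_derivative f (at y) a) (at y) b" for y
  define R where "R y = frechet_derivative (\<lambda>y. frechet_derivative f (at y) b) (at y) a" for y
  have "smooth_on U P" "smooth_on U R"
    unfolding P_def R_def by (intro smooth_on_frechet_derivative assms(1))+
  then have "isCont P x" "isCont R x"
    using assms smooth_on_imp_continuous_on continuous_on_eq_continuous_at by blast+
  have "dist (P x) (R x) < 2 * e" if "e > 0" for e
  proof -
    obtain d1 where d1: "d1 > 0" "\<And>y. dist y x < d1 \<Longrightarrow> dist (P y) (P x) < e"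
      using \<open>isCont P x\<close> \<open>e > 0\<close> unfolding continuous_at_eps_delta by blast
    obtain d2 where d2: "d2 > 0" "\<And>y. dist y x < d2 \<Longrightarrow> dist (R y) (R x) < e"
      using \<open>isCont R x\<close> \<open>e > 0\<close> unfolding continuous_at_eps_delta by blast
    obtain d3 where d3: "d3 > 0" "\<And>y. dist y x < d3 \<Longrightarrow> y \<in> U"
      using assms(2,3) unfolding open_dist by blast
    define d where "d = min d1 (min d2 d3)"
    \<comment> \<open>This size keeps the whole parallelogram within distance d / 2 of
      \<open>x\<close>; the summand 1 covers the case that \<open>a\<close> and \<open>b\<close>
      both vanish.\<close>
    define h where "h = d / (2 * (norm a + norm b + 1))"
    have pos: "norm a + norm b + 1 > 0" "d > 0"
      using d1 d2 d3 norm_ge_zero[of a] norm_ge_zero[of b] by (auto simp: d_def intro: add_nonneg_pos)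
    then have h: "h > 0" by (simp add: h_def)
    have near: "dist (x + s *\<^sub>R a + t *\<^sub>R b) x < d" if "0 \<le> s" "s \<le> h" "0 \<le> t" "t \<le> h" for s t
    proof -
      have "dist (x + s *\<^sub>R a + t *\<^sub>R b) x = norm (s *\<^sub>R a + t *\<^sub>R b)" by (simp add: dist_norm)
      also have "\<dots> \<le> norm (s *\<^sub>R a) + norm (t *\<^sub>R b)" by (rule norm_triangle_ineq)
      also have "\<dots> \<le> h * norm a + h * norm b" using that by (auto intro!: add_mono mult_right_mono)
      also have "\<dots> \<le> h * (norm a + norm b + 1)" using h by (simp add: algebra_simps)
      also have "\<dots> = d / 2" using pos by (simp add: h_def field_simps)
      finally show ?thesis using pos by simp
    qed
    have near': "x + s *\<^sub>R b + t *\<^sub>R a = x + t *\<^sub>R a + s *\<^sub>R b" for s t by simp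
    have U: "x + s *\<^sub>R a + t *\<^sub>R b \<in> U" if "0 \<le> s" "s \<le> h" "0 \<le> t" "t \<le> h" for s t
      using near[OF that] by (intro d3(2)) (simp add: d_def)
    have U': "x + s *\<^sub>R b + t *\<^sub>R a \<in> U" if "0 \<le> s" "s \<le> h" "0 \<le> t" "t \<le> h" for s t
      unfolding near' by (rule U[OF that(3,4,1,2)])
    obtain s t where st: "0 \<le> s" "s \<le> h" "0 \<le> t" "t \<le> h"
      "f (x + h *\<^sub>R a + h *\<^sub>R b) - f (x + h *\<^sub>R a) - f (x + h *\<^sub>R b) + f x = h * h * P (x + s *\<^sub>R a + t *\<^sub>R b)"
      using second_difference_mvt[OF assms(1) h U] unfolding P_def by blast
    obtain s' t' where st': "0 \<le> s'" "s' \<le> h" "0 \<le> t'" "t' \<le> h"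
      "f (x + h *\<^sub>R b + h *\<^sub>R a) - f (x + h *\<^sub>R b) - f (x + h *\<^sub>R a) + f x = h * h * R (x + s' *\<^sub>R b + t' *\<^sub>R a)"
      using second_difference_mvt[OF assms(1) h U'] unfolding R_def by blast
    have "h * h * P (x + s *\<^sub>R a + t *\<^sub>R b) = h * h * R (x + s' *\<^sub>R b + t' *\<^sub>R a)"
      using st(5) st'(5) near'[of h h] by (simp add: algebra_simps)
    then have eq: "P (x + s *\<^sub>R a + t *\<^sub>R b) = R (x + t' *\<^sub>R a + s' *\<^sub>R b)" using h near' by simp
    have "dist (P (x + s *\<^sub>R a + t *\<^sub>R b)) (P x) < e"
      using near[OF st(1-4)] by (intro d1(2)) (simp add: d_def)
    moreover have "dist (R (x + t' *\<^sub>R a + s' *\<^sub>R b)) (R x) < e"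
      using near[OF st'(3,4,1,2)] by (intro d2(2)) (simp add: d_def)
    ultimately show ?thesis using eq by (simp add: dist_real_def)
  qed
  then have "dist (P x) (R x) \<le> 0"
    using field_le_epsilon[of "dist (P x) (R x)" 0] by (metis add_0 less_imp_le mult_2 field_sum_of_halves half_gt_zero)
  then show ?thesis unfolding P_def R_def by simp
qed

lemma frechet_derivative_symmetric:
  fixes f :: "'a::real_normed_vector \<Rightarrow> 'b::euclidean_space"
  assumes "smooth_on U f" "open U" "x \<in> U"
  shows "frechet_derivative (\<lambda>y. frechet_derivative f (at y) a) (at x) b
       = frechet_derivative (\<lambda>y. frechet_derivative f (at y) b) (at x) a"
proof (rule euclidean_eqI)
  fix i :: 'b assume "i \<in> Basis"
  have comp: "frechet_derivative (\<lambda>y. F y \<bullet> i) (at y) v = frechet_derivative F (at y) v \<bullet> i"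
    if "smooth_on U F" "y \<in> U" for F :: "'a \<Rightarrow> 'b" and y v
    using frechet_derivative_at[OF has_derivative_inner_left[OF smooth_on_has_derivative[OF that]]] by metis
  have smi: "smooth_on U (\<lambda>y. f y \<bullet> i)" using assms by (intro smooth_intros)
  have second: "frechet_derivative (\<lambda>y. frechet_derivative (\<lambda>y. f y \<bullet> i) (at y) v) (at x) w
      = frechet_derivative (\<lambda>y. frechet_derivative f (at y) v) (at x) w \<bullet> i" for v w
  proof -
    have "frechet_derivative (\<lambda>y. frechet_derivative (\<lambda>y. f y \<bullet> i) (at y) v) (at x)
        = frechet_derivative (\<lambda>y. frechet_derivative f (at y) v \<bullet> i) (at x)"
      by (rule frechet_derivative_transform_within_open[OF _ assms(2,3)])
        (use comp assms smi in \<open>auto intro: smooth_on_differentiable smooth_on_frechet_derivative\<close>)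
    then show ?thesis using comp[OF smooth_on_frechet_derivative[OF assms(1)] assms(3)] by simp
  qed
  show "frechet_derivative (\<lambda>y. frechet_derivative f (at y) a) (at x) b \<bullet> i
      = frechet_derivative (\<lambda>y. frechet_derivative f (at y) b) (at x) a \<bullet> i"
    using frechet_derivative_symmetric_real[OF smi assms(2,3), of a b] second by simp
qed

section \<open>Manifolds\<close>

lemma chart_inv_left: "is_chart P c \<Longrightarrow> p \<in> fst c \<Longrightarrow> chart_inv c (snd c p) = p"
  unfolding chart_inv_def is_chart_def by simp

lemma chart_inv_in: "x \<in> snd c ` fst c \<Longrightarrow> chart_inv c x \<in> fst c"
  unfolding chart_inv_def by (rule inv_into_into)

lemma chart_inv_right: "x \<in> snd c ` fst c \<Longrightarrow> snd c (chart_inv c x) = x"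
  unfolding chart_inv_def by (rule f_inv_into_f)

lemma transition_apply: "is_chart P c \<Longrightarrow> p \<in> fst c \<Longrightarrow> transition c d (snd c p) = snd d p"
  by (simp add: transition_def chart_inv_left)

lemma compatible_sym: "compatible c d \<longleftrightarrow> compatible d c"
  unfolding compatible_def by (auto simp: Int_commute)

lemma compatible_smooth:
  "compatible c d \<Longrightarrow> smooth_on (snd c ` (fst c \<inter> fst d)) (transition c d)"
  "compatible c d \<Longrightarrow> open (snd c ` (fst c \<inter> fst d))"
  by (auto simp: compatible_def)

lemma transition_has_derivative:
  assumes "compatible c d" "p \<in> fst c \<inter> fst d"
  shows "(transition c d has_derivative frechet_derivative (transition c d) (at (snd c p))) (at (snd c p))"
    "linear (frechet_derivative (transition c d) (at (snd c p)))"
  using smooth_on_has_derivative smooth_on_linear_derivative compatible_smooth[OF assms(1)] assms(2) by blast+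

text \<open>The charts \<open>d\<close> and \<open>e\<close> need not be compatible with each other, which is what makes the
  lemma applicable to the charts of an orientation.\<close>

lemma transition_cocycle_has_derivative:
  assumes "is_chart P c" "is_chart P d" "compatible c d" "compatible d e"
    and p: "p \<in> fst c" "p \<in> fst d" "p \<in> fst e"
  shows "(transition c e has_derivative
      (\<lambda>v. frechet_derivative (transition d e) (at (snd d p)) (frechet_derivative (transition c d) (at (snd c p)) v)))
      (at (snd c p))"
proof -
  have "(transition d e has_derivative frechet_derivative (transition d e) (at (transition c d (snd c p))))
      (at (transition c d (snd c p)))"
    using transition_has_derivative(1)[OF assms(4), of p] p transition_apply[OF assms(1) p(1)] by simp
  then have "((\<lambda>x. transition d e (transition c d x)) has_derivative
      (\<lambda>v. frechet_derivative (transition d e) (at (snd d p)) (frechet_derivative (transition c d) (at (snd c p)) v)))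
      (at (snd c p))"
    using diff_chain_at[OF transition_has_derivative(1)[OF assms(3), of p]] p transition_apply[OF assms(1) p(1), of d]
    by (simp add: o_def)
  then show ?thesis
  proof (rule has_derivative_transform_within_open[OF _ compatible_smooth(2)[OF assms(3)]])
    show "snd c p \<in> snd c ` (fst c \<inter> fst d)" using p by blast
    show "transition d e (transition c d x) = transition c e x" if "x \<in> snd c ` (fst c \<inter> fst d)" for x
      using that transition_apply[OF assms(1), where d = d] transition_apply[OF assms(1), where d = e]
        transition_apply[OF assms(2), where d = e] by auto
  qed
qed

lemma transition_cocycle:
  assumes "is_chart P c" "is_chart P d" "compatible c d" "compatible d e"
    and "p \<in> fst c" "p \<in> fst d" "p \<in> fst e"
  shows "frechet_derivative (transition d e) (at (snd d p)) (frechet_derivative (transition c d) (at (snd c p)) v)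
       = frechet_derivative (transition c e) (at (snd c p)) v"
  using frechet_derivative_at[OF transition_cocycle_has_derivative[OF assms]] by (simp add: fun_eq_iff)

lemma transition_self:
  assumes "is_chart P c" "p \<in> fst c"
  shows "frechet_derivative (transition c c) (at (snd c p)) = (\<lambda>v. v)"
proof (rule frechet_derivative_at[symmetric])
  show "(transition c c has_derivative (\<lambda>v. v)) (at (snd c p))"
    by (rule has_derivative_transform_within_open[OF has_derivative_ident, of "snd c ` fst c"])
      (use assms transition_apply[OF assms(1), where d = c] in \<open>auto simp: is_chart_def\<close>)
qed

section \<open>The topology defined by an atlas\<close>

lemma openin_manifold_topology:
  assumes "smooth_atlas (points M) (atlas M)"
  shows "openin (manifold_topology M) W \<longleftrightarrow> W \<subseteq> points M \<and> (\<forall>c\<in>atlas M. open (snd c ` (W \<inter> fst c)))"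
proof -
  have inj: "inj_on (snd c) (fst c)" if "c \<in> atlas M" for c
    using assms that by (auto simp: smooth_atlas_def is_chart_def)
  have "istopology (\<lambda>W. W \<subseteq> points M \<and> (\<forall>c\<in>atlas M. open (snd c ` (W \<inter> fst c))))"
    unfolding istopology_def
  proof (intro conjI allI impI ballI)
    fix S T c assume S: "S \<subseteq> points M \<and> (\<forall>c\<in>atlas M. open (snd c ` (S \<inter> fst c)))"
      and T: "T \<subseteq> points M \<and> (\<forall>c\<in>atlas M. open (snd c ` (T \<inter> fst c)))" and c: "c \<in> atlas M"
    \<comment> \<open>Taking images commutes with this intersection because the chart is injective
      on its domain.\<close>
    have "snd c ` (S \<inter> T \<inter> fst c) = snd c ` (S \<inter> fst c) \<inter> snd c ` (T \<inter> fst c)"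
      using inj[OF c] by (auto simp: inj_on_def)
    then show "open (snd c ` (S \<inter> T \<inter> fst c))" using S T c by auto
  next
    fix K c assume K: "\<forall>S\<in>K. S \<subseteq> points M \<and> (\<forall>c\<in>atlas M. open (snd c ` (S \<inter> fst c)))" and c: "c \<in> atlas M"
    have "snd c ` (\<Union>K \<inter> fst c) = (\<Union>S\<in>K. snd c ` (S \<inter> fst c))" by blast
    then show "open (snd c ` (\<Union>K \<inter> fst c))" using K c by auto
  qed blast+
  then show ?thesis by (simp add: manifold_topology_def topology_inverse')
qed

lemma topspace_manifold_topology:
  assumes "smooth_atlas (points M) (atlas M)"
  shows "topspace (manifold_topology M) = points M"
proof -
  have "open (snd c ` (points M \<inter> fst c))" if "c \<in> atlas M" for c
    using assms that unfolding smooth_atlas_def is_chart_def by (metis Int_absorb1)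
  then have "openin (manifold_topology M) (points M)"
    by (simp add: openin_manifold_topology[OF assms])
  then show ?thesis
    by (metis assms openin_manifold_topology openin_subset openin_topspace subset_antisym)
qed

text \<open>Continuity of the coordinate map: seen in another chart \<open>d\<close>, the set is the
  preimage of \<open>V\<close> under a transition map that is continuous on an open set.\<close>

lemma openin_chart_vimage:
  assumes "smooth_atlas (points M) (atlas M)" "c \<in> atlas M" "open V"
  shows "openin (manifold_topology M) {p \<in> fst c. snd c p \<in> V}"
  unfolding openin_manifold_topology[OF assms(1)]
proof (intro conjI ballI)
  show "{p \<in> fst c. snd c p \<in> V} \<subseteq> points M"
    using assms by (auto simp: smooth_atlas_def is_chart_def)
  fix d assume d: "d \<in> atlas M"
  then have cd: "compatible d c" "is_chart (points M) d" using assms by (auto simp: smooth_atlas_def)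
  have "snd d ` ({p \<in> fst c. snd c p \<in> V} \<inter> fst d) = snd d ` (fst d \<inter> fst c) \<inter> transition d c -` V"
    using transition_apply[OF cd(2), where d = c] by auto
  moreover have "open (snd d ` (fst d \<inter> fst c) \<inter> transition d c -` V)"
    using compatible_smooth[OF cd(1)] assms(3) smooth_on_imp_continuous_on continuous_on_open_vimage
    by (metis Int_commute)
  ultimately show "open (snd d ` ({p \<in> fst c. snd c p \<in> V} \<inter> fst d))" by simp
qed

lemma openin_chart_domain:
  assumes "smooth_atlas (points M) (atlas M)" "c \<in> atlas M"
  shows "openin (manifold_topology M) (fst c)"
  using openin_chart_vimage[OF assms open_UNIV] by simp

text \<open>From left to right, apply the Lindelof property to the cover by chart domains; from
  right to left, pull a countable base of the model space back through countably many charts. The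
  right-hand side passes directly to products and cotangent bundles, whose charts are built from
  given charts.\<close>

lemma second_countable_iff_countable_subatlas:
  fixes M :: "('a, 'e::euclidean_space) manifold"
  assumes at: "smooth_atlas (points M) (atlas M)"
  shows "second_countable (manifold_topology M) \<longleftrightarrow>
    (\<exists>A\<subseteq>atlas M. countable A \<and> (\<Union>c\<in>A. fst c) = points M)" (is "?L \<longleftrightarrow> ?R")
proof
  assume ?L
  then have L: "Lindelof_space (manifold_topology M)" by (rule second_countable_imp_Lindelof_space)
  have "\<forall>U\<in>fst ` atlas M. openin (manifold_topology M) U" "\<Union>(fst ` atlas M) = topspace (manifold_topology M)"
    using openin_chart_domain[OF at] at topspace_manifold_topology[OF at] by (auto simp: smooth_atlas_def)
  then obtain V where V: "countable V" "V \<subseteq> fst ` atlas M" "\<Union>V = points M"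
    using L topspace_manifold_topology[OF at] unfolding Lindelof_space_def by (metis (no_types, lifting))
  then obtain A where "A \<subseteq> atlas M" "countable A" "V = fst ` A"
    using countable_subset_image by metis
  with V show ?R by (intro exI[of _ A]) auto
next
  assume ?R
  then obtain A where A: "A \<subseteq> atlas M" "countable A" "(\<Union>c\<in>A. fst c) = points M" by blast
  obtain \<B> :: "'e set set" where B: "countable \<B>" "topological_basis \<B>"
    using ex_countable_basis by blast
  show ?L
    unfolding second_countable_def
  proof (intro exI[of _ "(\<lambda>(c, V). {p \<in> fst c. snd c p \<in> V}) ` (A \<times> \<B>)"] conjI allI impI ballI)
    show "countable ((\<lambda>(c, V). {p \<in> fst c. snd c p \<in> V}) ` (A \<times> \<B>))" using A B by auto
    show "openin (manifold_topology M) W" if "W \<in> (\<lambda>(c, V). {p \<in> fst c. snd c p \<in> V}) ` (A \<times> \<B>)" for W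
      using that A B openin_chart_vimage[OF at] by (auto simp: topological_basis_open)
    fix U p assume U: "openin (manifold_topology M) U \<and> p \<in> U"
    then have "p \<in> points M" using openin_manifold_topology[OF at] by blast
    then obtain c where c: "c \<in> A" "p \<in> fst c" using A by blast
    then have "open (snd c ` (U \<inter> fst c))" "snd c p \<in> snd c ` (U \<inter> fst c)"
      using U A openin_manifold_topology[OF at] by blast+
    then obtain V where V: "V \<in> \<B>" "snd c p \<in> V" "V \<subseteq> snd c ` (U \<inter> fst c)"
      using B(2) topological_basisE by metis
    have "inj_on (snd c) (fst c)" using at c A by (auto simp: smooth_atlas_def is_chart_def)
    then have "{p \<in> fst c. snd c p \<in> V} \<subseteq> U" using V(3) by (blast dest: inj_onD)
    then show "\<exists>W\<in>(\<lambda>(c, V). {p \<in> fst c. snd c p \<in> V}) ` (A \<times> \<B>). p \<in> W \<and> W \<subseteq> U"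
      using c V by (intro bexI[of _ "{p \<in> fst c. snd c p \<in> V}"]) auto
  qed
qed

text \<open>Two points of a common chart are separated in the model space, so only pairs without a
  common chart remain to be treated.\<close>

lemma Hausdorff_manifold_topologyI:
  assumes at: "smooth_atlas (points M) (atlas M)"
    and sep: "\<And>p q. p \<in> points M \<Longrightarrow> q \<in> points M \<Longrightarrow> p \<noteq> q \<Longrightarrow> \<nexists>c. c \<in> atlas M \<and> p \<in> fst c \<and> q \<in> fst c \<Longrightarrow>
      \<exists>U V. openin (manifold_topology M) U \<and> openin (manifold_topology M) V \<and> p \<in> U \<and> q \<in> V \<and> U \<inter> V = {}"
  shows "Hausdorff_space (manifold_topology M)"
  unfolding Hausdorff_space_def topspace_manifold_topology[OF at]
proof (intro allI impI)
  fix p q assume pq: "p \<in> points M \<and> q \<in> points M \<and> p \<noteq> q"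
  show "\<exists>U V. openin (manifold_topology M) U \<and> openin (manifold_topology M) V \<and> p \<in> U \<and> q \<in> V \<and> disjnt U V"
  proof (cases "\<exists>c. c \<in> atlas M \<and> p \<in> fst c \<and> q \<in> fst c")
    case True
    then obtain c where c: "c \<in> atlas M" "p \<in> fst c" "q \<in> fst c" by blast
    have "inj_on (snd c) (fst c)" using at c by (auto simp: smooth_atlas_def is_chart_def)
    then have "snd c p \<noteq> snd c q" using c pq by (auto simp: inj_on_def)
    then obtain U V where UV: "open U" "open V" "snd c p \<in> U" "snd c q \<in> V" "U \<inter> V = {}"
      using hausdorff by metis
    show ?thesis
      by (intro exI[of _ "{p \<in> fst c. snd c p \<in> U}"] exI[of _ "{p \<in> fst c. snd c p \<in> V}"])
        (use UV c openin_chart_vimage[OF at] in \<open>auto simp: disjnt_def\<close>)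
  next
    case False
    then show ?thesis using sep pq unfolding disjnt_def by metis
  qed
qed

lemma smooth_manifold_separate:
  assumes "smooth_manifold M" "p \<noteq> q" "p \<in> points M" "q \<in> points M"
  obtains U V where "openin (manifold_topology M) U" "openin (manifold_topology M) V" "p \<in> U" "q \<in> V" "U \<inter> V = {}"
  using assms topspace_manifold_topology[of M]
  unfolding smooth_manifold_def Hausdorff_space_def disjnt_def by (metis (no_types, lifting))

lemma smooth_manifold_euclidean: "smooth_manifold (euclidean_manifold :: ('e::euclidean_space, 'e) manifold)"
proof -
  have at: "smooth_atlas (points (euclidean_manifold :: ('e, 'e) manifold)) (atlas euclidean_manifold)"
    by (auto simp: smooth_atlas_def euclidean_manifold_def is_chart_def compatible_def transition_def
        chart_inv_def id_def o_def intro!: smooth_on_ident)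
  moreover have "Hausdorff_space (manifold_topology (euclidean_manifold :: ('e, 'e) manifold))"
    by (rule Hausdorff_manifold_topologyI[OF at]) (auto simp: euclidean_manifold_def)
  moreover have "second_countable (manifold_topology (euclidean_manifold :: ('e, 'e) manifold))"
    unfolding second_countable_iff_countable_subatlas[OF at]
    by (intro exI[of _ "{(UNIV, id)}"]) (auto simp: euclidean_manifold_def)
  ultimately show ?thesis by (simp add: smooth_manifold_def)
qed

section \<open>Products of manifolds\<close>

definition prod_chart :: "('a, 'e) chart \<Rightarrow> ('b, 'f) chart \<Rightarrow> ('a \<times> 'b, 'e \<times> 'f) chart" where
  "prod_chart c d = (fst c \<times> fst d, map_prod (snd c) (snd d))"

lemma atlas_product_manifold:
  "atlas (product_manifold M N) = {prod_chart c d | c d. c \<in> atlas M \<and> d \<in> atlas N}"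
  by (auto simp: product_manifold_def prod_chart_def)

lemma points_product_manifold: "points (product_manifold M N) = points M \<times> points N"
  by (simp add: product_manifold_def)

lemma prod_chart_simps:
  "fst (prod_chart c d) = fst c \<times> fst d"
  "snd (prod_chart c d) p = (snd c (fst p), snd d (snd p))"
  by (simp_all add: prod_chart_def map_prod_def split_beta)

lemma image_prod_chart: "snd (prod_chart c d) ` (A \<times> B) = (snd c ` A) \<times> (snd d ` B)"
  by (force simp: prod_chart_simps)

lemma is_chart_prod_chart: "is_chart P c \<Longrightarrow> is_chart Q d \<Longrightarrow> is_chart (P \<times> Q) (prod_chart c d)"
  unfolding is_chart_def prod_chart_simps(1) image_prod_chart
  by (auto simp: prod_chart_simps(2) inj_on_def intro!: open_Times)

text \<open>One half of \<open>compatible\<close>; the other half is the same statement with the two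
  charts exchanged.\<close>

lemma compatible_prod_chart_aux:
  assumes "is_chart P c" "is_chart Q d" "compatible c c'" "compatible d d'"
  shows "smooth_on (snd (prod_chart c d) ` (fst (prod_chart c d) \<inter> fst (prod_chart c' d')))
      (transition (prod_chart c d) (prod_chart c' d'))"
    "open (snd (prod_chart c d) ` (fst (prod_chart c d) \<inter> fst (prod_chart c' d')))"
proof -
  let ?S = "snd c ` (fst c \<inter> fst c') \<times> snd d ` (fst d \<inter> fst d')"
  have eq: "snd (prod_chart c d) ` (fst (prod_chart c d) \<inter> fst (prod_chart c' d')) = ?S"
    by (simp only: prod_chart_simps(1) Times_Int_Times image_prod_chart)
  have o: "open ?S"
    by (intro open_Times compatible_smooth(2) assms(3,4))
  show "open (snd (prod_chart c d) ` (fst (prod_chart c d) \<inter> fst (prod_chart c' d')))"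
    unfolding eq by (rule o)
  show "smooth_on (snd (prod_chart c d) ` (fst (prod_chart c d) \<inter> fst (prod_chart c' d')))
      (transition (prod_chart c d) (prod_chart c' d'))"
    unfolding eq
  proof (rule smooth_on_cong[OF o])
    show "smooth_on ?S (\<lambda>x. (transition c c' (fst x), transition d d' (snd x)))"
      by (intro smooth_on_Pair o smooth_on_compose[OF compatible_smooth(1)[OF assms(3)] o]
          smooth_on_compose[OF compatible_smooth(1)[OF assms(4)] o]
          smooth_on_fst[OF o smooth_on_ident] smooth_on_snd[OF o smooth_on_ident]) auto
    fix x assume "x \<in> ?S"
    then obtain p q where pq: "p \<in> fst c" "q \<in> fst d" "x = snd (prod_chart c d) (p, q)"
      by (auto simp: prod_chart_simps)
    then have "transition (prod_chart c d) (prod_chart c' d') x = snd (prod_chart c' d') (p, q)"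
      using transition_apply[OF is_chart_prod_chart[OF assms(1,2)], of "(p, q)"] by (simp add: prod_chart_simps)
    then show "(transition c c' (fst x), transition d d' (snd x)) = transition (prod_chart c d) (prod_chart c' d') x"
      using pq transition_apply[OF assms(1)] transition_apply[OF assms(2)] by (simp add: prod_chart_simps)
  qed
qed

lemma smooth_atlas_product_manifold:
  assumes "smooth_atlas (points M) (atlas M)" "smooth_atlas (points N) (atlas N)"
  shows "smooth_atlas (points (product_manifold M N)) (atlas (product_manifold M N))"
proof -
  have M: "is_chart (points M) c" "compatible c c'" if "c \<in> atlas M" "c' \<in> atlas M" for c c'
    using that assms by (auto simp: smooth_atlas_def)
  have N: "is_chart (points N) c" "compatible c c'" if "c \<in> atlas N" "c' \<in> atlas N" for c c'
    using that assms by (auto simp: smooth_atlas_def)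
  have "compatible (prod_chart c d) (prod_chart c' d')"
    if "c \<in> atlas M" "d \<in> atlas N" "c' \<in> atlas M" "d' \<in> atlas N" for c d c' d'
    using compatible_prod_chart_aux[OF M(1)[OF that(1,1)] N(1)[OF that(2,2)] M(2)[OF that(1,3)] N(2)[OF that(2,4)]]
      compatible_prod_chart_aux[OF M(1)[OF that(3,3)] N(1)[OF that(4,4)] M(2)[OF that(3,1)] N(2)[OF that(4,2)]]
    unfolding compatible_def by (simp add: Int_commute)
  moreover have "is_chart (points M \<times> points N) (prod_chart c d)" if "c \<in> atlas M" "d \<in> atlas N" for c d
    using that M N is_chart_prod_chart by blast
  moreover have "(\<Union>c\<in>atlas (product_manifold M N). fst c) = (\<Union>c\<in>atlas M. fst c) \<times> (\<Union>c\<in>atlas N. fst c)"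
  proof (intro set_eqI iffI)
    fix x assume "x \<in> (\<Union>c\<in>atlas M. fst c) \<times> (\<Union>c\<in>atlas N. fst c)"
    then obtain c d where "c \<in> atlas M" "d \<in> atlas N" "x \<in> fst (prod_chart c d)"
      unfolding prod_chart_simps by blast
    then show "x \<in> (\<Union>c\<in>atlas (product_manifold M N). fst c)" unfolding atlas_product_manifold by blast
  next
    fix x assume "x \<in> (\<Union>c\<in>atlas (product_manifold M N). fst c)"
    then obtain c d where "c \<in> atlas M" "d \<in> atlas N" "x \<in> fst (prod_chart c d)"
      unfolding atlas_product_manifold by blast
    then show "x \<in> (\<Union>c\<in>atlas M. fst c) \<times> (\<Union>c\<in>atlas N. fst c)" unfolding prod_chart_simps by blast
  qed
  ultimately show ?thesis
    using assms by (auto simp: smooth_atlas_def atlas_product_manifold points_product_manifold)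
qed

lemma openin_product_manifold_Times:
  assumes "smooth_atlas (points M) (atlas M)" "smooth_atlas (points N) (atlas N)"
    "openin (manifold_topology M) U" "openin (manifold_topology N) V"
  shows "openin (manifold_topology (product_manifold M N)) (U \<times> V)"
  unfolding openin_manifold_topology[OF smooth_atlas_product_manifold[OF assms(1,2)]]
proof (intro conjI ballI)
  show "U \<times> V \<subseteq> points (product_manifold M N)"
    using assms openin_manifold_topology[OF assms(1)] openin_manifold_topology[OF assms(2)]
    by (intro subsetI) (auto simp: points_product_manifold)
  fix e assume "e \<in> atlas (product_manifold M N)"
  then obtain c d where e: "c \<in> atlas M" "d \<in> atlas N" "e = prod_chart c d"
    unfolding atlas_product_manifold mem_Collect_eq by (elim exE conjE) 
  have "open (snd c ` (U \<inter> fst c))" "open (snd d ` (V \<inter> fst d))"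
    using assms(3,4) e(1,2) unfolding openin_manifold_topology[OF assms(1)] openin_manifold_topology[OF assms(2)]
    by simp_all
  then show "open (snd e ` (U \<times> V \<inter> fst e))"
    unfolding e(3) prod_chart_simps(1) Times_Int_Times image_prod_chart by (rule open_Times)
qed

lemma smooth_manifold_product:
  assumes "smooth_manifold M" "smooth_manifold N"
  shows "smooth_manifold (product_manifold M N)"
proof -
  have M: "smooth_atlas (points M) (atlas M)" and N: "smooth_atlas (points N) (atlas N)"
    using assms by (auto simp: smooth_manifold_def)
  note MN = smooth_atlas_product_manifold[OF M N]
  have "\<exists>U V. openin (manifold_topology (product_manifold M N)) U \<and> openin (manifold_topology (product_manifold M N)) V
      \<and> x \<in> U \<and> y \<in> V \<and> U \<inter> V = {}" if xy: "x \<in> points M \<times> points N" "y \<in> points M \<times> points N" "x \<noteq> y" for x y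
  proof (cases "fst x = fst y")
    case True
    then have "snd x \<noteq> snd y" using xy by (simp add: prod_eq_iff)
    then obtain U V where "openin (manifold_topology N) U" "openin (manifold_topology N) V" "snd x \<in> U" "snd y \<in> V" "U \<inter> V = {}"
      by (rule smooth_manifold_separate[OF assms(2)]) (use xy in auto)
    moreover have "openin (manifold_topology M) (points M)"
      using topspace_manifold_topology[OF M] openin_topspace by metis
    ultimately show ?thesis using that
      by (intro exI[of _ "points M \<times> U"] exI[of _ "points M \<times> V"])
        (auto intro!: openin_product_manifold_Times M N simp: mem_Times_iff)
  next
    case False
    then obtain U V where "openin (manifold_topology M) U" "openin (manifold_topology M) V" "fst x \<in> U" "fst y \<in> V" "U \<inter> V = {}"
      by (rule smooth_manifold_separate[OF assms(1)]) (use xy in auto)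
    moreover have "openin (manifold_topology N) (points N)"
      using topspace_manifold_topology[OF N] openin_topspace by metis
    ultimately show ?thesis using that
      by (intro exI[of _ "U \<times> points N"] exI[of _ "V \<times> points N"])
        (auto intro!: openin_product_manifold_Times M N simp: mem_Times_iff)
  qed
  then have "Hausdorff_space (manifold_topology (product_manifold M N))"
    by (intro Hausdorff_manifold_topologyI[OF MN]) (simp add: points_product_manifold)
  moreover have "second_countable (manifold_topology (product_manifold M N))"
  proof -
    obtain A B where AB: "A \<subseteq> atlas M" "countable A" "(\<Union>c\<in>A. fst c) = points M"
      "B \<subseteq> atlas N" "countable B" "(\<Union>c\<in>B. fst c) = points N"
      using assms second_countable_iff_countable_subatlas[OF M] second_countable_iff_countable_subatlas[OF N]
      by (auto simp: smooth_manifold_def)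
    show ?thesis
      unfolding second_countable_iff_countable_subatlas[OF MN]
    proof (intro exI[of _ "(\<lambda>(c, d). prod_chart c d) ` (A \<times> B)"] conjI)
      show "(\<lambda>(c, d). prod_chart c d) ` (A \<times> B) \<subseteq> atlas (product_manifold M N)"
        unfolding atlas_product_manifold
      proof (rule subsetI, elim imageE)
        fix x y assume "x = (\<lambda>(c, d). prod_chart c d) y" "y \<in> A \<times> B"
        then show "x \<in> {prod_chart c d |c d. c \<in> atlas M \<and> d \<in> atlas N}"
          using AB by (intro CollectI exI[of _ "fst y"] exI[of _ "snd y"]) (auto simp: split_beta)
      qed
      show "(\<Union>c\<in>(\<lambda>(c, d). prod_chart c d) ` (A \<times> B). fst c) = points (product_manifold M N)"
        unfolding points_product_manifold AB(3,6)[symmetric] by (auto simp: prod_chart_simps)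
    qed (use AB in auto)
  qed
  ultimately show ?thesis using MN by (simp add: smooth_manifold_def)
qed

section \<open>Tangent and cotangent spaces\<close>

context
  fixes M :: "('a, 'e::euclidean_space) manifold"
  assumes at: "smooth_atlas (points M) (atlas M)"
begin

lemma atlas_is_chart: "c \<in> atlas M \<Longrightarrow> is_chart (points M) c"
  and atlas_compatible: "c \<in> atlas M \<Longrightarrow> d \<in> atlas M \<Longrightarrow> compatible c d"
  using at by (auto simp: smooth_atlas_def)

lemma coord_vector_self: "c \<in> charts_at M p \<Longrightarrow> coord_vector M c p e c = e"
  using transition_self[OF atlas_is_chart] by (simp add: coord_vector_def charts_at_def)

lemma coord_vector_in_tangent_space:
  assumes c: "c \<in> charts_at M p"
  shows "coord_vector M c p e \<in> tangent_space M p"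
proof -
  have "frechet_derivative (transition d d') (at (snd d p)) (frechet_derivative (transition c d) (at (snd c p)) e)
      = frechet_derivative (transition c d') (at (snd c p)) e" if "d \<in> charts_at M p" "d' \<in> charts_at M p" for d d'
    using transition_cocycle[of "points M" c d d' p e] that c atlas_is_chart atlas_compatible
    by (auto simp: charts_at_def)
  then show ?thesis by (auto simp: tangent_space_def coord_vector_def)
qed

lemma tangent_transform:
  assumes "v \<in> tangent_space M p" "c \<in> charts_at M p" "d \<in> charts_at M p"
  shows "v d = frechet_derivative (transition c d) (at (snd c p)) (v c)"
  using assms unfolding tangent_space_def by blast

text \<open>Together with \<open>coord_vector_self\<close> this makes evaluation at \<open>c\<close>
  and \<open>coord_vector M c p\<close> mutually inverse: every chart around \<open>p\<close>
  identifies the tangent space with the model space.\<close>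

lemma tangent_vector_eq_coord_vector:
  assumes "v \<in> tangent_space M p" "c \<in> charts_at M p"
  shows "coord_vector M c p (v c) = v"
proof
  fix d
  show "coord_vector M c p (v c) d = v d"
  proof (cases "d \<in> charts_at M p")
    case True
    then show ?thesis using tangent_transform[OF assms True] by (simp add: coord_vector_def)
  next
    case False
    \<comment> \<open>At charts not containing \<open>p\<close> both sides have the conventional
      value 0, so the two functions agree everywhere.\<close>
    moreover have "v d = 0" using assms(1) False unfolding tangent_space_def by blast
    ultimately show ?thesis by (simp add: coord_vector_def)
  qed
qed

lemma linear_transition_at:
  assumes "c \<in> charts_at M p" "d \<in> charts_at M p"
  shows "linear (frechet_derivative (transition c d) (at (snd c p)))"
  using assms transition_has_derivative(2)[of c d p] atlas_compatible[of c d] by (auto simp: charts_at_def)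

lemma coord_vector_add:
  assumes "c \<in> charts_at M p"
  shows "coord_vector M c p (a + b) = tangent_add (coord_vector M c p a) (coord_vector M c p b)"
  using linear_add[OF linear_transition_at[OF assms]] by (auto simp: coord_vector_def tangent_add_def fun_eq_iff)

lemma coord_vector_scale:
  assumes "c \<in> charts_at M p"
  shows "coord_vector M c p (r *\<^sub>R a) = tangent_scale r (coord_vector M c p a)"
  using linear_scale[OF linear_transition_at[OF assms]] by (auto simp: coord_vector_def tangent_scale_def fun_eq_iff)

lemma coord_vector_change:
  assumes "c \<in> charts_at M p" "d \<in> charts_at M p"
  shows "coord_vector M c p a = coord_vector M d p (frechet_derivative (transition c d) (at (snd c p)) a)"
  using tangent_vector_eq_coord_vector[OF coord_vector_in_tangent_space[OF assms(1)] assms(2), of a] assms(2)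
  by (metis (full_types) coord_vector_def)

lemma linear_on_tangent_coord:
  assumes "c \<in> charts_at M p" "linear_on_tangent M p \<xi>"
  shows "linear (\<lambda>a. \<xi> (coord_vector M c p a))"
  using assms(2) coord_vector_add[OF assms(1)] coord_vector_scale[OF assms(1)] coord_vector_in_tangent_space[OF assms(1)]
  by (intro linearI) (simp_all add: linear_on_tangent_def)

lemma tangent_spaceI:
  assumes "\<And>c. c \<notin> charts_at M p \<Longrightarrow> v c = 0"
    "\<And>c d. c \<in> charts_at M p \<Longrightarrow> d \<in> charts_at M p \<Longrightarrow>
      v d = frechet_derivative (transition c d) (at (snd c p)) (v c)"
  shows "v \<in> tangent_space M p"
  unfolding tangent_space_def by (intro CollectI conjI allI impI ballI) (erule assms, erule assms(2))

lemma tangent_space_outside: "v \<in> tangent_space M p \<Longrightarrow> c \<notin> charts_at M p \<Longrightarrow> v c = 0"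
  unfolding tangent_space_def by blast

lemma tangent_add_in:
  assumes "u \<in> tangent_space M p" "v \<in> tangent_space M p"
  shows "tangent_add u v \<in> tangent_space M p"
proof (rule tangent_spaceI)
  show "tangent_add u v c = 0" if "c \<notin> charts_at M p" for c
    using tangent_space_outside[OF assms(1) that] tangent_space_outside[OF assms(2) that]
    by (simp add: tangent_add_def)
  show "tangent_add u v d = frechet_derivative (transition c d) (at (snd c p)) (tangent_add u v c)"
    if "c \<in> charts_at M p" "d \<in> charts_at M p" for c d
    unfolding tangent_add_def linear_add[OF linear_transition_at[OF that]]
      tangent_transform[OF assms(1) that] tangent_transform[OF assms(2) that] ..
qed

lemma tangent_scale_in:
  assumes "u \<in> tangent_space M p"
  shows "tangent_scale r u \<in> tangent_space M p"
proof (rule tangent_spaceI)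
  show "tangent_scale r u c = 0" if "c \<notin> charts_at M p" for c
    using tangent_space_outside[OF assms that] by (simp add: tangent_scale_def)
  show "tangent_scale r u d = frechet_derivative (transition c d) (at (snd c p)) (tangent_scale r u c)"
    if "c \<in> charts_at M p" "d \<in> charts_at M p" for c d
    unfolding tangent_scale_def linear_scale[OF linear_transition_at[OF that]]
      tangent_transform[OF assms that] ..
qed

section \<open>Covector coordinates and the charts of the cotangent bundle\<close>

definition covector_coords :: "('a, 'e) chart \<Rightarrow> 'a \<Rightarrow> (('a, 'e) tangent \<Rightarrow> real) \<Rightarrow> 'e" where
  "covector_coords c p \<xi> = (\<Sum>b\<in>Basis. \<xi> (coord_vector M c p b) *\<^sub>R b)"

text \<open>By linearity the coordinates of a covector are its Riesz vector in the chart. Later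
  arguments test against an arbitrary vector instead of summing over a basis.\<close>

lemma covector_coords_inner:
  assumes "c \<in> charts_at M p" "\<xi> \<in> cotangent_space M p"
  shows "covector_coords c p \<xi> \<bullet> a = \<xi> (coord_vector M c p a)"
proof -
  have l: "linear (\<lambda>a. \<xi> (coord_vector M c p a))"
    using linear_on_tangent_coord assms by (auto simp: cotangent_space_def)
  have "\<xi> (coord_vector M c p a) = \<xi> (coord_vector M c p (\<Sum>b\<in>Basis. (a \<bullet> b) *\<^sub>R b))"
    by (simp add: euclidean_representation)
  also have "\<dots> = (\<Sum>b\<in>Basis. (a \<bullet> b) * \<xi> (coord_vector M c p b))"
    using linear_sum[OF l, of "\<lambda>b. (a \<bullet> b) *\<^sub>R b" Basis] linear_scale[OF l] by simp
  also have "\<dots> = covector_coords c p \<xi> \<bullet> a"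
    unfolding covector_coords_def inner_sum_left by (intro sum.cong) (simp_all add: inner_commute)
  finally show ?thesis by simp
qed

text \<open>The contragredient law in adjoint form: the Jacobian acts on the test vector, so no
  inverse occurs. This shape can be differentiated directly when tangent vectors of the bundle are
  compared.\<close>

lemma covector_coords_change:
  assumes "c \<in> charts_at M p" "d \<in> charts_at M p" "\<xi> \<in> cotangent_space M p"
  shows "covector_coords c p \<xi> \<bullet> a = covector_coords d p \<xi> \<bullet> frechet_derivative (transition c d) (at (snd c p)) a"
  using covector_coords_inner assms coord_vector_change[OF assms(1,2)] by metis

lemma cotangent_chart_simps:
  "fst (cotangent_chart M c) = Sigma (fst c) (cotangent_space M)"
  "snd (cotangent_chart M c) P = (snd c (fst P), covector_coords c (fst P) (snd P))"
  by (simp_all add: cotangent_chart_def covector_coords_def split_beta)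

lemma covector_coords_bij:
  assumes c: "c \<in> charts_at M p"
  shows "bij_betw (covector_coords c p) (cotangent_space M p) UNIV"
proof (rule bij_betwI')
  fix \<xi> \<eta> assume \<xi>: "\<xi> \<in> cotangent_space M p" and \<eta>: "\<eta> \<in> cotangent_space M p"
  have "\<xi> v = \<eta> v" if "covector_coords c p \<xi> = covector_coords c p \<eta>" for v
  proof (cases "v \<in> tangent_space M p")
    case True
    then show ?thesis
      using covector_coords_inner[OF c \<xi>, of "v c"] covector_coords_inner[OF c \<eta>, of "v c"] that
        tangent_vector_eq_coord_vector[OF True c] by simp
  next
    case False
    \<comment> \<open>Outside the tangent space both covectors are \<open>undefined\<close>, being
      extensional.\<close>
    then show ?thesis using \<xi> \<eta> by (auto simp: cotangent_space_def extensional_def)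
  qed
  then show "covector_coords c p \<xi> = covector_coords c p \<eta> \<longleftrightarrow> \<xi> = \<eta>" by blast
next
  fix y :: 'e
  \<comment> \<open>The covector with coordinates \<open>y\<close>: read a tangent vector in the
    chart \<open>c\<close> and pair it with \<open>y\<close>.\<close>
  define \<xi> where "\<xi> = restrict (\<lambda>v. y \<bullet> v c) (tangent_space M p)"
  have \<xi>: "\<xi> \<in> cotangent_space M p"
    using tangent_add_in tangent_scale_in
    by (auto simp: \<xi>_def cotangent_space_def linear_on_tangent_def tangent_add_def tangent_scale_def inner_add_right)
  have "covector_coords c p \<xi> = y"
  proof (rule euclidean_eqI)
    show "covector_coords c p \<xi> \<bullet> b = y \<bullet> b" for b
      using covector_coords_inner[OF c \<xi>] coord_vector_self[OF c] coord_vector_in_tangent_space[OF c]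
      by (simp add: \<xi>_def)
  qed
  with \<xi> show "\<exists>\<xi>\<in>cotangent_space M p. y = covector_coords c p \<xi>" by blast
qed simp

lemma image_cotangent_chart:
  assumes "c \<in> atlas M" "A \<subseteq> fst c"
  shows "snd (cotangent_chart M c) ` Sigma A (cotangent_space M) = snd c ` A \<times> UNIV"
proof -
  have "\<exists>\<xi>\<in>cotangent_space M p. covector_coords c p \<xi> = y" if "p \<in> A" for p y
  proof -
    have "c \<in> charts_at M p" using assms that by (auto simp: charts_at_def)
    then have "y \<in> covector_coords c p ` cotangent_space M p"
      using covector_coords_bij unfolding bij_betw_def by simp
    then show ?thesis by (auto simp: image_iff)
  qed
  note surj = this
  show ?thesis
  proof (intro set_eqI iffI)
    fix z assume "z \<in> snd c ` A \<times> (UNIV :: 'e set)"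
    then obtain p where p: "p \<in> A" "fst z = snd c p" by auto
    obtain \<xi> where "\<xi> \<in> cotangent_space M p" "covector_coords c p \<xi> = snd z" using surj[OF p(1)] by blast
    then show "z \<in> snd (cotangent_chart M c) ` Sigma A (cotangent_space M)"
      using p by (intro image_eqI[of _ _ "(p, \<xi>)"]) (simp_all add: cotangent_chart_simps prod_eq_iff)
  qed (auto simp: cotangent_chart_simps)
qed

lemma is_chart_cotangent_chart:
  assumes "c \<in> atlas M"
  shows "is_chart (points (cotangent_bundle M)) (cotangent_chart M c)"
proof -
  have c: "fst c \<subseteq> points M" "inj_on (snd c) (fst c)" "open (snd c ` fst c)"
    using atlas_is_chart[OF assms] by (auto simp: is_chart_def)
  have "inj_on (covector_coords c p) (cotangent_space M p)" if "p \<in> fst c" for p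
    using covector_coords_bij[of c p] assms that unfolding bij_betw_def charts_at_def by blast
  then have "inj_on (snd (cotangent_chart M c)) (fst (cotangent_chart M c))"
    using c(2) by (auto simp: inj_on_def cotangent_chart_simps)
  then show ?thesis
    using c image_cotangent_chart[OF assms order_refl]
    by (auto simp: is_chart_def cotangent_bundle_def cotangent_chart_simps intro!: open_Times)
qed

lemma smooth_transition_cotangent_chart:
  assumes c: "c \<in> atlas M" and d: "d \<in> atlas M"
  defines "S \<equiv> snd (cotangent_chart M c) ` (fst (cotangent_chart M c) \<inter> fst (cotangent_chart M d))"
  shows "smooth_on S (transition (cotangent_chart M c) (cotangent_chart M d))" "open S"
proof -
  let ?V = "snd c ` (fst c \<inter> fst d)"
  have "fst (cotangent_chart M c) \<inter> fst (cotangent_chart M d) = Sigma (fst c \<inter> fst d) (cotangent_space M)"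
    by (auto simp: cotangent_chart_simps)
  then have S: "S = ?V \<times> UNIV"
    unfolding S_def using image_cotangent_chart[OF c, of "fst c \<inter> fst d"] by simp
  have cd: "compatible c d" and dc: "compatible d c" using atlas_compatible c d by auto
  show o: "open S" unfolding S using compatible_smooth(2)[OF cd] by (intro open_Times) auto
  have Fim: "transition c d ` ?V \<subseteq> snd d ` (fst d \<inter> fst c)"
    using transition_apply[OF atlas_is_chart[OF c], where d = d] by (simp add: image_subset_iff)
  have F: "smooth_on S (\<lambda>z. transition c d (fst z))"
    using smooth_on_compose[OF compatible_smooth(1)[OF cd] o smooth_on_fst[OF o smooth_on_ident]]
    by (auto simp: S)
  show "smooth_on S (transition (cotangent_chart M c) (cotangent_chart M d))"
  proof (rule smooth_on_cong[OF o])
    \<comment> \<open>By \<open>covector_coords_change\<close> with \<open>c\<close> and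
      \<open>d\<close> exchanged, the new covector coordinates are the pairings of the old ones with
      the images of the basis under the derivative of \<open>transition d c\<close>, taken at the
      image point.\<close>
    show "smooth_on S (\<lambda>z. (transition c d (fst z),
        \<Sum>b\<in>Basis. (snd z \<bullet> frechet_derivative (transition d c) (at (transition c d (fst z))) b) *\<^sub>R b))"
      using Fim by (intro smooth_intros o F smooth_on_frechet_derivative_apply[OF compatible_smooth(1)[OF dc]]) (auto simp: S)
    fix z assume "z \<in> S"
    then obtain p \<xi> where p: "p \<in> fst c" "p \<in> fst d" "\<xi> \<in> cotangent_space M p"
      and z: "z = snd (cotangent_chart M c) (p, \<xi>)"
      by (auto simp: S_def cotangent_chart_simps)
    then have T: "transition (cotangent_chart M c) (cotangent_chart M d) z = snd (cotangent_chart M d) (p, \<xi>)"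
      using transition_apply[OF is_chart_cotangent_chart[OF c], of "(p, \<xi>)"] by (simp add: cotangent_chart_simps)
    have z': "fst z = snd c p" "snd z = covector_coords c p \<xi>" by (auto simp: z cotangent_chart_simps)
    have "covector_coords d p \<xi> \<bullet> b = snd z \<bullet> frechet_derivative (transition d c) (at (transition c d (fst z))) b" for b
      using covector_coords_change[of d p c \<xi> b] p c d transition_apply[OF atlas_is_chart[OF c] p(1)]
      by (simp add: z' charts_at_def)
    then have "covector_coords d p \<xi> = (\<Sum>b\<in>Basis. (snd z \<bullet> frechet_derivative (transition d c) (at (transition c d (fst z))) b) *\<^sub>R b)"
      by (metis (no_types, lifting) euclidean_representation sum.cong)
    then show "(transition c d (fst z),
        \<Sum>b\<in>Basis. (snd z \<bullet> frechet_derivative (transition d c) (at (transition c d (fst z))) b) *\<^sub>R b)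
        = transition (cotangent_chart M c) (cotangent_chart M d) z"
      unfolding T using transition_apply[OF atlas_is_chart[OF c] p(1)] by (simp add: cotangent_chart_simps z')
  qed
qed

lemma smooth_atlas_cotangent_bundle: "smooth_atlas (points (cotangent_bundle M)) (atlas (cotangent_bundle M))"
proof -
  have "compatible (cotangent_chart M c) (cotangent_chart M d)" if "c \<in> atlas M" "d \<in> atlas M" for c d
    using smooth_transition_cotangent_chart[OF that] smooth_transition_cotangent_chart[OF that(2,1)]
    unfolding compatible_def by (metis Int_commute)
  moreover have "(\<Union>c\<in>atlas M. fst (cotangent_chart M c)) = points (cotangent_bundle M)"
    using at unfolding smooth_atlas_def by (auto simp: cotangent_chart_simps cotangent_bundle_def)
  ultimately show ?thesis
    using is_chart_cotangent_chart unfolding smooth_atlas_def by (auto simp: cotangent_bundle_def)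
qed

end

lemma smooth_manifold_cotangent_bundle:
  assumes "smooth_manifold M"
  shows "smooth_manifold (cotangent_bundle M)"
proof -
  have at: "smooth_atlas (points M) (atlas M)" using assms by (simp add: smooth_manifold_def)
  note TM = smooth_atlas_cotangent_bundle[OF at]
  have atlas: "atlas (cotangent_bundle M) = cotangent_chart M ` atlas M"
    and points: "points (cotangent_bundle M) = Sigma (points M) (cotangent_space M)"
    by (simp_all add: cotangent_bundle_def)
  \<comment> \<open>Continuity of the bundle projection: in a bundle chart the preimage of
    \<open>U\<close> is an open set times the whole fibre space.\<close>
  have proj: "openin (manifold_topology (cotangent_bundle M)) (Sigma U (cotangent_space M))"
    if U: "openin (manifold_topology M) U" for U
    unfolding openin_manifold_topology[OF TM]
  proof (intro conjI ballI)
    show "Sigma U (cotangent_space M) \<subseteq> points (cotangent_bundle M)"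
      using U openin_manifold_topology[OF at] by (auto simp: points)
    fix c assume "c \<in> atlas (cotangent_bundle M)"
    then obtain c' where c': "c = cotangent_chart M c'" "c' \<in> atlas M" by (auto simp: atlas)
    have "Sigma U (cotangent_space M) \<inter> fst c = Sigma (U \<inter> fst c') (cotangent_space M)"
      by (auto simp: c' cotangent_chart_simps[OF at])
    then have "snd c ` (Sigma U (cotangent_space M) \<inter> fst c) = snd c' ` (U \<inter> fst c') \<times> UNIV"
      using image_cotangent_chart[OF at c'(2), of "U \<inter> fst c'"] c' by simp
    then show "open (snd c ` (Sigma U (cotangent_space M) \<inter> fst c))"
      using U c' openin_manifold_topology[OF at] by (auto intro!: open_Times)
  qed
  have "Hausdorff_space (manifold_topology (cotangent_bundle M))"
  proof (rule Hausdorff_manifold_topologyI[OF TM])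
    fix x y
    assume x: "x \<in> points (cotangent_bundle M)" and y: "y \<in> points (cotangent_bundle M)"
      and no: "\<nexists>c. c \<in> atlas (cotangent_bundle M) \<and> x \<in> fst c \<and> y \<in> fst c"
    \<comment> \<open>A cotangent chart contains entire fibres, so points over the same base point
      share a chart. The remaining pairs are separated by open sets of the base.\<close>
    have "fst x \<noteq> fst y"
    proof
      assume "fst x = fst y"
      moreover obtain c where "c \<in> atlas M" "fst x \<in> fst c"
      proof -
        have "fst x \<in> (\<Union>c\<in>atlas M. fst c)"
          using x at unfolding points smooth_atlas_def by auto
        then show ?thesis using that by blast
      qed
      ultimately have "cotangent_chart M c \<in> atlas (cotangent_bundle M)"
        "x \<in> fst (cotangent_chart M c)" "y \<in> fst (cotangent_chart M c)"
        using x y by (auto simp: points atlas cotangent_chart_simps[OF at])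
      then show False using no by blast
    qed
    then obtain U V where UV: "openin (manifold_topology M) U" "openin (manifold_topology M) V"
      "fst x \<in> U" "fst y \<in> V" "U \<inter> V = {}"
      by (rule smooth_manifold_separate[OF assms]) (use x y in \<open>auto simp: points\<close>)
    show "\<exists>U V. openin (manifold_topology (cotangent_bundle M)) U \<and> openin (manifold_topology (cotangent_bundle M)) V
        \<and> x \<in> U \<and> y \<in> V \<and> U \<inter> V = {}"
      by (intro exI[of _ "Sigma U (cotangent_space M)"] exI[of _ "Sigma V (cotangent_space M)"])
        (use UV proj x y in \<open>auto simp: points\<close>)
  qed
  moreover obtain A where A: "A \<subseteq> atlas M" "countable A" "(\<Union>c\<in>A. fst c) = points M"
    using assms second_countable_iff_countable_subatlas[OF at] by (auto simp: smooth_manifold_def)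
  then have "second_countable (manifold_topology (cotangent_bundle M))"
    unfolding second_countable_iff_countable_subatlas[OF TM]
    by (intro exI[of _ "cotangent_chart M ` A"]) (auto simp: atlas points cotangent_chart_simps[OF at])
  ultimately show ?thesis using TM by (simp add: smooth_manifold_def)
qed

section \<open>The linear model\<close>

lemma inner_transpose_mult: "a \<bullet> (transpose A *v b) = (A *v a) \<bullet> b" for a :: "real ^ 'n" and A :: "real ^ 'n ^ 'm"
  by (metis dot_lmul_matrix inner_commute transpose_matrix_vector)

lemma matrix_entry_inner: "B $ i $ j = axis i 1 \<bullet> (B *v axis j 1)" for B :: "real ^ 'n ^ 'm"
  by (simp add: inner_axis' matrix_vector_mul_component) (simp add: inner_axis)

section \<open>Orthonormal frames of a positive definite form\<close>

text \<open>One Gram-Schmidt step for the inner product \<open>u \<bullet> (M *v v)\<close>.\<close>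

lemma exists_form_orthonormal_extension:
  fixes M :: "real ^ 'n ^ 'n"
  assumes pos: "\<And>v. v \<noteq> 0 \<Longrightarrow> v \<bullet> (M *v v) > 0" and sym: "\<And>u v. u \<bullet> (M *v v) = v \<bullet> (M *v u)"
    and S: "finite S" "card S < CARD('n)" "\<And>e f. e \<in> S \<Longrightarrow> f \<in> S \<Longrightarrow> e \<bullet> (M *v f) = (if e = f then 1 else 0)"
  shows "\<exists>v. v \<bullet> (M *v v) = 1 \<and> (\<forall>e\<in>S. e \<bullet> (M *v v) = 0)"
proof -
  have "dim (span S) < DIM(real ^ 'n)" using S(1,2) dim_le_card[of S S] by (simp add: span_superset dim_span)
  then have "span S \<noteq> UNIV" by (metis dim_UNIV less_irrefl)
  then obtain b where b: "b \<notin> span S" by blast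
  \<comment> \<open>Removes the \<open>M\<close>-orthogonal projection onto the span of
    \<open>S\<close>; since \<open>b\<close> lies outside that span, the remainder is nonzero and
    can be normalised.\<close>
  define w where "w = b - (\<Sum>f\<in>S. (f \<bullet> (M *v b)) *\<^sub>R f)"
  have "w \<noteq> 0"
  proof
    assume "w = 0"
    then have "b = (\<Sum>f\<in>S. (f \<bullet> (M *v b)) *\<^sub>R f)" by (simp add: w_def)
    then show False using b by (metis (no_types, lifting) span_base span_scale span_sum)
  qed
  then have q: "w \<bullet> (M *v w) > 0" by (rule pos)
  have orth: "e \<bullet> (M *v w) = 0" if "e \<in> S" for e
  proof -
    have "M *v w = M *v b - (\<Sum>f\<in>S. (f \<bullet> (M *v b)) *\<^sub>R (M *v f))"
      unfolding w_def matrix_vector_mult_diff_distrib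
      by (simp add: linear_sum[OF matrix_vector_mul_linear] matrix_vector_mult_scaleR)
    then have "e \<bullet> (M *v w) = e \<bullet> (M *v b) - (\<Sum>f\<in>S. (f \<bullet> (M *v b)) * (e \<bullet> (M *v f)))"
      by (simp add: inner_diff_right inner_sum_right)
    also have "(\<Sum>f\<in>S. (f \<bullet> (M *v b)) * (e \<bullet> (M *v f))) = (\<Sum>f\<in>S. if e = f then f \<bullet> (M *v b) else 0)"
      using S(3)[OF that] by (intro sum.cong) auto
    also have "\<dots> = e \<bullet> (M *v b)" using S(1) that by simp
    finally show ?thesis by simp
  qed
  let ?c = "1 / sqrt (w \<bullet> (M *v w))"
  show ?thesis
  proof (intro exI[of _ "?c *\<^sub>R w"] conjI ballI)
    show "e \<bullet> (M *v (?c *\<^sub>R w)) = 0" if "e \<in> S" for e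
      using orth[OF that] by (simp add: matrix_vector_mult_scaleR)
    have "(?c *\<^sub>R w) \<bullet> (M *v (?c *\<^sub>R w)) = ?c * ?c * (w \<bullet> (M *v w))"
      by (simp add: matrix_vector_mult_scaleR)
    also have "\<dots> = 1" using q by (simp add: real_sqrt_mult_self)
    finally show "(?c *\<^sub>R w) \<bullet> (M *v (?c *\<^sub>R w)) = 1" .
  qed
qed

lemma exists_form_orthonormal_frame:
  fixes M :: "real ^ 'n ^ 'n"
  assumes pos: "\<And>v. v \<noteq> 0 \<Longrightarrow> v \<bullet> (M *v v) > 0" and sym: "\<And>u v. u \<bullet> (M *v v) = v \<bullet> (M *v u)"
  obtains A :: "real ^ 'n ^ 'n" where "transpose A ** M ** A = mat 1"
proof -
  have "\<exists>S. finite S \<and> card S = k \<and> (\<forall>e\<in>S. \<forall>f\<in>S. e \<bullet> (M *v f) = (if e = f then 1 else 0))" if "k \<le> CARD('n)" for k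
    using that
  proof (induction k)
    case 0
    then show ?case by (intro exI[of _ "{}"]) auto
  next
    case (Suc k)
    then obtain S where S: "finite S" "card S = k" "\<forall>e\<in>S. \<forall>f\<in>S. e \<bullet> (M *v f) = (if e = f then 1 else 0)" by auto
    then obtain v where v: "v \<bullet> (M *v v) = 1" "\<forall>e\<in>S. e \<bullet> (M *v v) = 0"
      using exists_form_orthonormal_extension[OF pos sym, of S] Suc.prems by auto
    then have "v \<notin> S" by auto
    then show ?case
    proof (intro exI[of _ "insert v S"] conjI ballI)
      show "e \<bullet> (M *v f) = (if e = f then 1 else 0)" if "e \<in> insert v S" "f \<in> insert v S" for e f
      proof (cases "e = v")
        case True
        then show ?thesis using that v \<open>v \<notin> S\<close> sym[of v f] by (cases "f = v") auto
      next
        case False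
        then show ?thesis using that v S(3) by (cases "f = v") auto
      qed
    qed (use S \<open>v \<notin> S\<close> in auto)
  qed
  then obtain S where S: "finite S" "card S = CARD('n)" "\<forall>e\<in>S. \<forall>f\<in>S. e \<bullet> (M *v f) = (if e = f then 1 else 0)"
    by blast
  obtain f where f: "bij_betw f (UNIV :: 'n set) S"
    using finite_same_card_bij[of "UNIV :: 'n set" S] S by auto
  \<comment> \<open>The orthonormal vectors become the columns, so the entries of
    \<open>transpose A ** M ** A\<close> are their mutual inner products.\<close>
  define A :: "real ^ 'n ^ 'n" where "A = (\<chi> i j. f j $ i)"
  have col: "A *v axis j 1 = f j" for j
    by (simp add: A_def matrix_vector_mul_component vec_eq_iff matrix_vector_mult_def axis_def if_distrib cong: if_cong)
  have "(transpose A ** M ** A) $ i $ j = mat 1 $ i $ j" for i j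
  proof -
    have "(transpose A ** M ** A) $ i $ j = axis i 1 \<bullet> ((transpose A ** M ** A) *v axis j 1)"
      by (rule matrix_entry_inner)
    also have "\<dots> = f i \<bullet> (M *v f j)"
      by (simp only: matrix_vector_mul_assoc[symmetric] inner_transpose_mult col)
    also have "\<dots> = mat 1 $ i $ j"
      using S(3) f by (auto simp: mat_def bij_betw_def inj_on_def)
    finally show ?thesis .
  qed
  then have "transpose A ** M ** A = mat 1" by (simp add: vec_eq_iff)
  then show ?thesis by (rule that)
qed

text \<open>Determinants of \<open>transpose A ** M ** A = mat 1\<close> give
  \<open>det M * (det A)\<^sup>2 = 1\<close>.\<close>

lemma det_pos_of_form_pos:
  fixes M :: "real ^ 'n ^ 'n"
  assumes pos: "\<And>v. v \<noteq> 0 \<Longrightarrow> v \<bullet> (M *v v) > 0" and sym: "\<And>u v. u \<bullet> (M *v v) = v \<bullet> (M *v u)"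
  shows "det M > 0"
proof -
  obtain A :: "real ^ 'n ^ 'n" where A: "transpose A ** M ** A = mat 1"
    by (rule exists_form_orthonormal_frame[OF pos sym])
  then have "det (transpose A ** M ** A) = 1" by simp
  then have "det M * (det A)\<^sup>2 = 1" by (simp add: det_mul power2_eq_square algebra_simps)
  then show ?thesis by (metis mult_zero_right not_less zero_le_power2 mult_nonpos_nonneg zero_less_one)
qed

text \<open>An orthonormal frame has \<open>det A\<close> equal to 1 / sqrt (det M) up to sign.
  Replacing \<open>A\<close> by \<open>- A\<close> preserves orthonormality and, the dimension 3
  being odd, reverses the sign. Here \<open>s * sqrt (det M)\<close> plays the role of the oriented
  volume form, which must take the value 1 on the frame.\<close>

lemma exists_oriented_orthonormal_frame:
  fixes M :: "real ^ 3 ^ 3"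
  assumes pos: "\<And>v. v \<noteq> 0 \<Longrightarrow> v \<bullet> (M *v v) > 0" and sym: "\<And>u v. u \<bullet> (M *v v) = v \<bullet> (M *v u)"
    and s: "\<bar>s\<bar> = 1"
  obtains A where "transpose A ** M ** A = mat 1" "s * sqrt (det M) * det A = 1"
proof -
  obtain A :: "real ^ 3 ^ 3" where A: "transpose A ** M ** A = mat 1"
    by (rule exists_form_orthonormal_frame[OF pos sym])
  then have "det (transpose A ** M ** A) = 1" by simp
  then have d: "det M * (det A)\<^sup>2 = 1" by (simp add: det_mul power2_eq_square algebra_simps)
  then have "sqrt (det M) * \<bar>det A\<bar> = 1"
    by (metis real_sqrt_abs real_sqrt_mult real_sqrt_one)
  moreover have "sqrt (det M) \<ge> 0" using det_pos_of_form_pos[OF pos sym] by simp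
  ultimately have "\<bar>s * sqrt (det M) * det A\<bar> = 1"
    using s by (simp add: abs_mult)
  moreover have "det (- A) = - det A" by (simp add: det_3)
  ultimately have "s * sqrt (det M) * det A = 1 \<or> s * sqrt (det M) * det (- A) = 1"
    by (simp add: abs_if split: if_splits)
  then consider "s * sqrt (det M) * det A = 1" | "s * sqrt (det M) * det (- A) = 1" by blast
  then show ?thesis
  proof cases
    case 1
    then show ?thesis using A that by blast
  next
    case 2
    have "transpose (- A) ** M ** (- A) = transpose A ** M ** A"
      by (simp add: matrix_matrix_mult_def transpose_def vec_eq_iff sum_negf)
    then show ?thesis using A that 2 by metis
  qed
qed

section \<open>The G_2 form on the complexified tangent space times a line\<close>

type_synonym split_vector = "((real ^ 3) \<times> (real ^ 3)) \<times> real"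

definition triple :: "real ^ 3 \<Rightarrow> real ^ 3 \<Rightarrow> real ^ 3 \<Rightarrow> real" where
  "triple a b c = a \<bullet> cross3 b c"

text \<open>The fundamental two-form \<omega>; for \<open>M = mat 1\<close> it is the sum of the e^i
  \<and> f^i.\<close>

definition pairing :: "real ^ 3 ^ 3 \<Rightarrow> split_vector \<Rightarrow> split_vector \<Rightarrow> real" where
  "pairing M u v = fst (fst u) \<bullet> (M *v snd (fst v)) - fst (fst v) \<bullet> (M *v snd (fst u))"

text \<open>With a vector of \<open>split_vector\<close> standing for $(e + i f, t)$, this is
  $dt \<and> \omega + \mathrm{Re}\,\Omega$, where $\omega$ pairs $e$ with $f$ by means of the inner product
  \<open>M\<close> and $\Omega$ is the complex volume form normalised by \<open>\<sigma>\<close>.\<close>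

definition g2_form :: "real ^ 3 ^ 3 \<Rightarrow> real \<Rightarrow> split_vector \<Rightarrow> split_vector \<Rightarrow> split_vector \<Rightarrow> real" where
  "g2_form M \<sigma> u v w =
     snd u * pairing M v w + snd v * pairing M w u + snd w * pairing M u v
     + \<sigma> * (triple (fst (fst u)) (fst (fst v)) (fst (fst w)) - triple (fst (fst u)) (snd (fst v)) (snd (fst w))
          - triple (snd (fst u)) (fst (fst v)) (snd (fst w)) - triple (snd (fst u)) (snd (fst v)) (fst (fst w)))"

text \<open>The complexification of \<open>A\<close>, acting alike on real and imaginary parts. Both
  parts can transform alike because \<open>split\<close> turns the vertical covector into a tangent
  vector.\<close>

definition split_frame :: "real ^ 3 ^ 3 \<Rightarrow> split_vector \<Rightarrow> split_vector" where
  "split_frame A u = ((A *v fst (fst u), A *v snd (fst u)), snd u)"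

lemma triple_matrix: "triple (A *v a) (A *v b) (A *v c) = det A * triple a b c"
proof -
  have "triple (A *v a) (A *v b) (A *v c) = a \<bullet> (transpose A *v cross3 (A *v b) (A *v c))"
    by (simp only: triple_def inner_transpose_mult)
  then show ?thesis by (simp only: cross_matrix_mult triple_def inner_scaleR_right)
qed

lemma pairing_frame: "pairing M (split_frame A u) (split_frame A v) = pairing (transpose A ** M ** A) u v"
  by (simp only: pairing_def split_frame_def fst_conv snd_conv inner_transpose_mult matrix_vector_mul_assoc[symmetric])

text \<open>The inner product pulls back by congruence, and a triple product picks up
  \<open>det A\<close>, which is absorbed into the normalisation. Both changes of chart and adapted
  frames are instances.\<close>

lemma g2_form_frame:
  "g2_form M \<sigma> (split_frame A u) (split_frame A v) (split_frame A w)
     = g2_form (transpose A ** M ** A) (\<sigma> * det A) u v w"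
proof -
  have [simp]: "fst (fst (split_frame A u)) = A *v fst (fst u)" "snd (fst (split_frame A u)) = A *v snd (fst u)"
    "snd (split_frame A u) = snd u" for u
    by (simp_all add: split_frame_def)
  show ?thesis unfolding g2_form_def pairing_frame by (simp add: triple_matrix algebra_simps)
qed

lemma linear_g2_form:
  "linear (\<lambda>u. g2_form M \<sigma> u v w)" "linear (\<lambda>u. g2_form M \<sigma> v u w)" "linear (\<lambda>u. g2_form M \<sigma> v w u)"
  unfolding g2_form_def pairing_def triple_def
  by (intro linearI; simp add: algebra_simps inner_add_left inner_add_right cross_add_left cross_add_right
      cross_mult_left cross_mult_right matrix_vector_right_distrib matrix_vector_mult_scaleR)+

lemma g2_form_alternating: "g2_form M \<sigma> u u v = 0" "g2_form M \<sigma> u v u = 0" "g2_form M \<sigma> v u u = 0"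
  by (simp_all add: g2_form_def pairing_def triple_def cross3_simps)

text \<open>Complex coordinates x^2 + i x^3, x^4 + i x^5, x^6 + i x^7 and real coordinate x^1. The
  minus signs of \<phi>_0 come from i^2 = -1 in the terms of Re \<Omega> with two imaginary
  parts.\<close>

definition split_R7 :: "real ^ 7 \<Rightarrow> split_vector" where
  "split_R7 u = ((vector [u $ 2, u $ 4, u $ 6], vector [u $ 3, u $ 5, u $ 7]), u $ 1)"

lemma g2_form_standard: "g2_form (mat 1) 1 (split_R7 u) (split_R7 v) (split_R7 w) = phi0 u v w"
proof -
  have T: "triple (vector [a1, a2, a3]) (vector [b1, b2, b3]) (vector [c1, c2, c3])
      = a1 * (b2 * c3 - b3 * c2) + a2 * (b3 * c1 - b1 * c3) + a3 * (b1 * c2 - b2 * c1)"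
    for a1 a2 a3 b1 b2 b3 c1 c2 c3
    by (simp add: triple_def cross3_def inner_vec_def sum_3 vector_3)
  have P: "pairing (mat 1) (split_R7 u) (split_R7 v) =
      (u $ 2 * v $ 3 - u $ 3 * v $ 2) + (u $ 4 * v $ 5 - u $ 5 * v $ 4) + (u $ 6 * v $ 7 - u $ 7 * v $ 6)" for u v
    unfolding pairing_def split_R7_def by (simp add: inner_vec_def sum_3 vector_3)
  have D: "dx3 i j k u v w = u $ i * (v $ j * w $ k - v $ k * w $ j) + v $ i * (u $ k * w $ j - u $ j * w $ k)
      + w $ i * (u $ j * v $ k - u $ k * v $ j)" for i j k
    unfolding dx3_def det_3 vector_3 by (simp only: algebra_simps)
  have F: "fst (fst (split_R7 u)) = vector [u $ 2, u $ 4, u $ 6]" "snd (fst (split_R7 u)) = vector [u $ 3, u $ 5, u $ 7]"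
    "snd (split_R7 u) = u $ 1" for u
    by (simp_all add: split_R7_def)
  \<comment> \<open>With all determinants expanded this is a polynomial identity in the 21
    coordinates of \<open>u\<close>, \<open>v\<close> and \<open>w\<close>.\<close>
  show ?thesis unfolding g2_form_def P F T phi0_def D mult_1_left by algebra
qed

lemma exhaust_7:
  fixes x :: 7
  shows "x = 1 \<or> x = 2 \<or> x = 3 \<or> x = 4 \<or> x = 5 \<or> x = 6 \<or> x = 7"
proof (induct x)
  case (of_int z)
  then have "0 \<le> z" and "z < 7" by simp_all
  then have "z = 0 \<or> z = 1 \<or> z = 2 \<or> z = 3 \<or> z = 4 \<or> z = 5 \<or> z = 6" by arith
  \<comment> \<open>The representative 0 is the index 7 of the type.\<close>
  then show ?case by auto
qed

lemma linear_split_R7: "linear split_R7"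
  by (rule linearI) (simp_all add: split_R7_def vec_eq_iff forall_3 vector_3)

lemma bij_split_R7: "bij split_R7"
proof (rule bijI)
  show "inj split_R7"
  proof (rule injI)
    fix u v assume "split_R7 u = split_R7 v"
    then have eqs: "u $ 1 = v $ 1" "u $ 2 = v $ 2" "u $ 3 = v $ 3" "u $ 4 = v $ 4" "u $ 5 = v $ 5" "u $ 6 = v $ 6" "u $ 7 = v $ 7"
      by (simp_all add: split_R7_def vec_eq_iff forall_3 vector_3)
    have "u $ i = v $ i" for i
      using exhaust_7[of i] by (elim disjE) (simp_all only: eqs)
    then show "u = v" by (simp add: vec_eq_iff)
  qed
  show "surj split_R7"
  proof (rule surjI)
    fix x
    show "split_R7 (\<chi> i. if i = 1 then snd x else if i = 2 then fst (fst x) $ 1 else if i = 3 then snd (fst x) $ 1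
       else if i = 4 then fst (fst x) $ 2 else if i = 5 then snd (fst x) $ 2 else if i = 6 then fst (fst x) $ 3
       else snd (fst x) $ 3) = x"
      by (simp add: split_R7_def prod_eq_iff vec_eq_iff forall_3 vector_3)
  qed
qed

section \<open>The Levi-Civita splitting in coordinates\<close>

lemma bounded_bilinear_matrix_vector_mult:
  "bounded_bilinear ((*v) :: real ^ 'n ^ 'm \<Rightarrow> real ^ 'n \<Rightarrow> real ^ 'm)"
  unfolding bilinear_conv_bounded_bilinear[symmetric] bilinear_def
  by (auto intro!: linearI simp: matrix_vector_mult_add_rdistrib matrix_vector_right_distrib
      matrix_vector_mult_scaleR scaleR_matrix_vector_assoc)

lemma bounded_bilinear_cross3: "bounded_bilinear cross3"
  using bilinear_cross by (simp add: bilinear_conv_bounded_bilinear)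

lemmas smooth_on_matrix_vector_mult [smooth_intros] = smooth_on_bilinear[OF bounded_bilinear_matrix_vector_mult]
lemmas smooth_on_cross3 [smooth_intros] = smooth_on_bilinear[OF bounded_bilinear_cross3]

lemma matrix_inv_mult_eq:
  fixes M :: "real ^ 'n ^ 'n"
  assumes "det M \<noteq> 0"
  shows "M *v (matrix_inv M *v v) = v" "matrix_inv M *v (M *v v) = v"
proof -
  have "invertible M" using assms invertible_det_nz by blast
  then have "M ** matrix_inv M = mat 1 \<and> matrix_inv M ** M = mat 1"
    unfolding invertible_def matrix_inv_def by (rule someI_ex)
  then show "M *v (matrix_inv M *v v) = v" "matrix_inv M *v (M *v v) = v"
    by (simp_all add: matrix_vector_mul_assoc)
qed

text \<open>\<open>matrix_inv\<close> is defined by choice, so smoothness is obtained from Cramer's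
  rule, which gives the components as quotients of determinants.\<close>

lemma smooth_on_matrix_inv_mult:
  fixes M :: "'a::real_normed_vector \<Rightarrow> real ^ 'n ^ 'n"
  assumes "open S" "smooth_on S M" "smooth_on S v" "\<And>x. x \<in> S \<Longrightarrow> det (M x) \<noteq> 0"
  shows "smooth_on S (\<lambda>x. matrix_inv (M x) *v v x)"
proof (rule smooth_on_cong[OF assms(1)])
  have entry: "smooth_on S (\<lambda>x. M x $ i $ j)" "smooth_on S (\<lambda>x. v x $ i)" for i j
    by (intro smooth_on_vec_nth assms)+
  then have "smooth_on S (\<lambda>x. (\<chi> i j. if j = k then v x $ i else M x $ i $ j) $ i $ j)" for i j k
    by (cases "j = k") simp_all
  then show "smooth_on S (\<lambda>x. \<chi> k. det (\<chi> i j. if j = k then v x $ i else M x $ i $ j) / det (M x))"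
    by (intro smooth_on_vec_lambda smooth_on_divide smooth_on_det entry assms)
  fix x assume "x \<in> S"
  then show "(\<chi> k. det (\<chi> i j. if j = k then v x $ i else M x $ i $ j) / det (M x)) = matrix_inv (M x) *v v x"
    using cramer[of "M x" "matrix_inv (M x) *v v x" "v x"] assms(4) matrix_inv_mult_eq(1)[of "M x"] by simp
qed

section \<open>Christoffel symbols and their transformation law\<close>

text \<open>Christoffel symbols of the first kind, contracted with three vectors: the Koszul formula
  for the inner product of \<open>y\<close> with the covariant derivative of the constant field
  \<open>b\<close> along \<open>a\<close>. With the index lowered, no inverse of \<open>G\<close>
  occurs.\<close>

definition christoffel :: "(real ^ 'n \<Rightarrow> real ^ 'n ^ 'n) \<Rightarrow> real ^ 'n \<Rightarrow> real ^ 'n \<Rightarrow> real ^ 'n \<Rightarrow> real ^ 'n \<Rightarrow> real" where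
  "christoffel G x y a b =
     (y \<bullet> (frechet_derivative G (at x) a *v b) + y \<bullet> (frechet_derivative G (at x) b *v a)
      - a \<bullet> (frechet_derivative G (at x) y *v b)) / 2"

text \<open>The product rule applied to \<open>eq\<close> in direction \<open>c\<close>. The
  Jacobian occurs twice in that identity, so two terms carry second derivatives \<open>B\<close> of
  the coordinate change.\<close>

lemma metric_derivative_transform:
  fixes G G' :: "real ^ 'n \<Rightarrow> real ^ 'n ^ 'n" and F :: "real ^ 'n \<Rightarrow> real ^ 'n"
  assumes V: "open V" "x \<in> V" and F: "smooth_on V F" and G: "smooth_on V G"
    and G': "G' differentiable (at (F x))"
    and eq: "\<And>x a b. x \<in> V \<Longrightarrow>
      a \<bullet> (G x *v b) = frechet_derivative F (at x) a \<bullet> (G' (F x) *v frechet_derivative F (at x) b)"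
  defines "A \<equiv> frechet_derivative F (at x)"
    and "B \<equiv> \<lambda>a b. frechet_derivative (\<lambda>x. frechet_derivative F (at x) b) (at x) a"
  shows "a \<bullet> (frechet_derivative G (at x) c *v b) =
      B c a \<bullet> (G' (F x) *v A b) + A a \<bullet> (frechet_derivative G' (at (F x)) (A c) *v A b) + A a \<bullet> (G' (F x) *v B c b)"
proof -
  have dG: "((\<lambda>x. a \<bullet> (G x *v b)) has_derivative (\<lambda>c. a \<bullet> (frechet_derivative G (at x) c *v b))) (at x)"
    by (intro has_derivative_inner_right
        bounded_linear.has_derivative[OF bounded_bilinear.bounded_linear_left[OF bounded_bilinear_matrix_vector_mult]]
        smooth_on_has_derivative[OF G V(2)])
  have dF: "((\<lambda>x. frechet_derivative F (at x) b) has_derivative (\<lambda>a. B a b)) (at x)" for b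
    unfolding B_def using smooth_on_has_derivative[OF smooth_on_frechet_derivative[OF F] V(2)] .
  have dG': "((\<lambda>x. G' (F x)) has_derivative (\<lambda>c. frechet_derivative G' (at (F x)) (A c))) (at x)"
    using diff_chain_at[OF smooth_on_has_derivative[OF F V(2)], of G' "frechet_derivative G' (at (F x))"] G'
    by (simp add: A_def o_def frechet_derivative_works)
  have "((\<lambda>x. frechet_derivative F (at x) a \<bullet> (G' (F x) *v frechet_derivative F (at x) b)) has_derivative
     (\<lambda>c. A a \<bullet> (G' (F x) *v B c b + frechet_derivative G' (at (F x)) (A c) *v A b) + B c a \<bullet> (G' (F x) *v A b))) (at x)"
    unfolding A_def
    by (intro has_derivative_inner bounded_bilinear.FDERIV[OF bounded_bilinear_matrix_vector_mult] dF dG'[unfolded A_def])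
  then have "((\<lambda>x. a \<bullet> (G x *v b)) has_derivative
     (\<lambda>c. A a \<bullet> (G' (F x) *v B c b + frechet_derivative G' (at (F x)) (A c) *v A b) + B c a \<bullet> (G' (F x) *v A b))) (at x)"
    by (rule has_derivative_transform_within_open[OF _ V]) (simp add: eq)
  from fun_cong[OF has_derivative_unique[OF dG this], of c] show ?thesis
    by (simp add: inner_add_right)
qed

text \<open>The three metric derivatives contribute six terms with \<open>B\<close>. By the symmetry
  of \<open>B\<close> and of the metric, four cancel in pairs and the other two coincide; with the
  factor 1/2 they form the inhomogeneous term.\<close>

lemma christoffel_transform:
  fixes G G' :: "real ^ 'n \<Rightarrow> real ^ 'n ^ 'n" and F :: "real ^ 'n \<Rightarrow> real ^ 'n"
  assumes V: "open V" "x \<in> V" and F: "smooth_on V F" and G: "smooth_on V G"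
    and G': "G' differentiable (at (F x))"
    and eq: "\<And>x a b. x \<in> V \<Longrightarrow>
      a \<bullet> (G x *v b) = frechet_derivative F (at x) a \<bullet> (G' (F x) *v frechet_derivative F (at x) b)"
    and sym: "\<And>a b. a \<bullet> (G' (F x) *v b) = b \<bullet> (G' (F x) *v a)"
  defines "A \<equiv> frechet_derivative F (at x)"
    and "B \<equiv> \<lambda>a b. frechet_derivative (\<lambda>x. frechet_derivative F (at x) b) (at x) a"
  shows "christoffel G x y a b = christoffel G' (F x) (A y) (A a) (A b) + A y \<bullet> (G' (F x) *v B a b)"
proof -
  have d: "a \<bullet> (frechet_derivative G (at x) c *v b) =
      B c a \<bullet> (G' (F x) *v A b) + A a \<bullet> (frechet_derivative G' (at (F x)) (A c) *v A b) + A a \<bullet> (G' (F x) *v B c b)"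
    for a b c
    unfolding A_def B_def by (rule metric_derivative_transform[OF V F G G' eq])
  have B: "B a b = B b a" for a b
    unfolding B_def by (rule frechet_derivative_symmetric[OF F V])
  show ?thesis
    unfolding christoffel_def d
    using sym[of "B a y" "A b"] sym[of "B b y" "A a"] B[of y a] B[of y b] B[of b a] sym[of "A a" "B b y"]
    by (simp add: field_simps)
qed

lemma linear_christoffel:
  assumes "G differentiable (at x)"
  shows "linear (\<lambda>a. christoffel G x y a b)" "linear (\<lambda>b. christoffel G x y a b)"
  using linear_add[OF linear_frechet_derivative[OF assms]] linear_scale[OF linear_frechet_derivative[OF assms]]
  unfolding christoffel_def
  by (auto intro!: linearI simp: inner_add_left inner_add_right matrix_vector_right_distrib matrix_vector_mult_add_rdistrib
      matrix_vector_mult_scaleR scaleR_matrix_vector_assoc[symmetric] field_simps)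

text \<open>In index notation \<Gamma>^k_ij \<xi>_k a^j: the inverse metric raises \<xi> to fit the
  symbols of the first kind. It is the rate of change of the coordinates of \<xi> under parallel
  transport in direction \<open>a\<close>.\<close>

definition christoffel_covector ::
  "(real ^ 'n \<Rightarrow> real ^ 'n ^ 'n) \<Rightarrow> real ^ 'n \<Rightarrow> real ^ 'n \<Rightarrow> real ^ 'n \<Rightarrow> real ^ 'n" where
  "christoffel_covector G x \<xi> a = (\<chi> i. christoffel G x (matrix_inv (G x) *v \<xi>) a (axis i 1))"

lemma christoffel_covector_inner:
  assumes "G differentiable (at x)"
  shows "christoffel_covector G x \<xi> a \<bullet> b = christoffel G x (matrix_inv (G x) *v \<xi>) a b"
proof -
  let ?y = "matrix_inv (G x) *v \<xi>"
  have "christoffel G x ?y a b = christoffel G x ?y a (\<Sum>i\<in>UNIV. b $ i *\<^sub>R axis i 1)"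
    using basis_expansion[of b] by (simp add: scalar_mult_eq_scaleR)
  also have "\<dots> = (\<Sum>i\<in>UNIV. b $ i * christoffel G x ?y a (axis i 1))"
    using linear_christoffel(2)[OF assms, of ?y a] by (simp add: linear_sum linear_scale)
  finally show ?thesis by (simp add: christoffel_covector_def inner_vec_def mult.commute)
qed

lemma linear_christoffel_covector:
  assumes "G differentiable (at x)"
  shows "linear (christoffel_covector G x \<xi>)"
  using linear_add[OF linear_christoffel(1)[OF assms]] linear_scale[OF linear_christoffel(1)[OF assms]]
  by (intro linearI) (simp_all add: christoffel_covector_def vec_eq_iff)

text \<open>For a tangent vector with coordinates $(a, \alpha)$ at the point $(x, \xi)$ of the cotangent
  bundle, the covector $\alpha - \Gamma(\xi, a)$ is its vertical part with respect to the
  Levi-Civita connection; \<open>split\<close> identifies that covector with a tangent vector of the base.\<close>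

definition split :: "(real ^ 3 \<Rightarrow> real ^ 3 ^ 3) \<Rightarrow> split_vector \<Rightarrow> split_vector \<Rightarrow> split_vector" where
  "split G z u =
     ((fst (fst u), matrix_inv (G (fst (fst z))) *v
         (snd (fst u) - christoffel_covector G (fst (fst z)) (snd (fst z)) (fst (fst u)))), snd u)"

definition unsplit :: "(real ^ 3 \<Rightarrow> real ^ 3 ^ 3) \<Rightarrow> split_vector \<Rightarrow> split_vector \<Rightarrow> split_vector" where
  "unsplit G z u =
     ((fst (fst u), G (fst (fst z)) *v snd (fst u) + christoffel_covector G (fst (fst z)) (snd (fst z)) (fst (fst u))), snd u)"

lemma split_unsplit:
  assumes "det (G (fst (fst z))) \<noteq> 0"
  shows "split G z (unsplit G z u) = u" "unsplit G z (split G z u) = u"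
  using assms by (simp_all add: split_def unsplit_def matrix_inv_mult_eq prod_eq_iff)

lemma linear_split:
  assumes "G differentiable (at (fst (fst z)))"
  shows "linear (split G z)" "linear (unsplit G z)"
  using linear_add[OF linear_christoffel_covector[OF assms]] linear_scale[OF linear_christoffel_covector[OF assms]]
  by (auto intro!: linearI simp: split_def unsplit_def matrix_vector_right_distrib matrix_vector_mult_diff_distrib
      matrix_vector_mult_scaleR algebra_simps)

text \<open>Naturality of raising an index: covectors that correspond under pullback by
  \<open>A\<close> have metric duals that correspond under \<open>A\<close>, when one inner product
  is the pullback of the other.\<close>

lemma matrix_inv_frame:
  fixes A M :: "real ^ 'n ^ 'n"
  assumes M: "det M \<noteq> 0" "det (transpose A ** M ** A) \<noteq> 0"
    and \<eta>: "\<And>b. \<eta> \<bullet> b = \<eta>' \<bullet> (A *v b)"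
  shows "matrix_inv M *v \<eta>' = A *v (matrix_inv (transpose A ** M ** A) *v \<eta>)"
proof -
  let ?N = "transpose A ** M ** A"
  have "det A \<noteq> 0" using M by (auto simp: det_mul)
  have "(M *v (A *v (matrix_inv ?N *v \<eta>))) \<bullet> c = \<eta>' \<bullet> c" for c
  proof -
    \<comment> \<open>\<open>A\<close> is invertible, so every test vector has the form
      \<open>A *v b\<close>.\<close>
    have c: "A *v (matrix_inv A *v c) = c" by (rule matrix_inv_mult_eq(1)[OF \<open>det A \<noteq> 0\<close>])
    have "(M *v (A *v (matrix_inv ?N *v \<eta>))) \<bullet> (A *v b) = (?N *v (matrix_inv ?N *v \<eta>)) \<bullet> b" for b
      by (simp only: matrix_vector_mul_assoc[symmetric] inner_commute[of _ b] inner_commute[of _ "A *v b"] inner_transpose_mult)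
    also have "(?N *v (matrix_inv ?N *v \<eta>)) \<bullet> b = \<eta>' \<bullet> (A *v b)" for b
      by (simp only: matrix_inv_mult_eq(1)[OF M(2)] \<eta>)
    finally show ?thesis using c by metis
  qed
  then have "M *v (A *v (matrix_inv ?N *v \<eta>)) = \<eta>'" by (metis vector_eq_rdot)
  then show ?thesis using matrix_inv_mult_eq(2)[OF M(1)] by metis
qed

text \<open>The assumption on \<alpha> is the derivative of the one on \<xi> in direction
  \<open>a\<close>; its term with \<open>B\<close> is what makes the covector component alone chart
  dependent. Subtracting the Christoffel covector leaves an honest covector, which is then raised by
  \<open>matrix_inv_frame\<close>.\<close>

lemma split_transform:
  fixes G G' :: "real ^ 3 \<Rightarrow> real ^ 3 ^ 3" and F :: "real ^ 3 \<Rightarrow> real ^ 3"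
  assumes V: "open V" "x \<in> V" and F: "smooth_on V F" and G: "smooth_on V G"
    and G': "G' differentiable (at (F x))"
    and eq: "\<And>x a b. x \<in> V \<Longrightarrow>
      a \<bullet> (G x *v b) = frechet_derivative F (at x) a \<bullet> (G' (F x) *v frechet_derivative F (at x) b)"
    and sym: "\<And>a b. a \<bullet> (G' (F x) *v b) = b \<bullet> (G' (F x) *v a)"
    and det: "det (G x) \<noteq> 0" "det (G' (F x)) \<noteq> 0"
  defines "A \<equiv> frechet_derivative F (at x)"
    and "B \<equiv> \<lambda>a b. frechet_derivative (\<lambda>x. frechet_derivative F (at x) b) (at x) a"
  assumes \<xi>: "\<And>b. \<xi> \<bullet> b = \<xi>' \<bullet> A b" and \<alpha>: "\<And>b. \<alpha> \<bullet> b = \<alpha>' \<bullet> A b + \<xi>' \<bullet> B a b"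
  shows "split G' ((F x, \<xi>'), t0') ((A a, \<alpha>'), t) = split_frame (matrix A) (split G ((x, \<xi>), t0) ((a, \<alpha>), t))"
proof -
  have linA: "linear A" unfolding A_def by (rule smooth_on_linear_derivative[OF F V(2)])
  then have mA: "matrix A *v b = A b" for b by (simp add: matrix_works)
  have Gx: "G x = transpose (matrix A) ** G' (F x) ** matrix A"
  proof -
    have "G x $ i $ j = (transpose (matrix A) ** G' (F x) ** matrix A) $ i $ j" for i j
      unfolding matrix_entry_inner eq[OF V(2)] matrix_vector_mul_assoc[symmetric] inner_transpose_mult mA
      unfolding A_def ..
    then show ?thesis by (simp add: vec_eq_iff)
  qed
  have raise: "matrix_inv (G' (F x)) *v \<eta>' = A (matrix_inv (G x) *v \<eta>)" if "\<And>b. \<eta> \<bullet> b = \<eta>' \<bullet> A b" for \<eta> \<eta>'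
    using matrix_inv_frame[of "G' (F x)" "matrix A" \<eta> \<eta>'] det Gx that mA by simp
  define y where "y = matrix_inv (G x) *v \<xi>"
  have y': "matrix_inv (G' (F x)) *v \<xi>' = A y" unfolding y_def by (rule raise[OF \<xi>])
  have "(\<alpha> - christoffel_covector G x \<xi> a) \<bullet> b = (\<alpha>' - christoffel_covector G' (F x) \<xi>' (A a)) \<bullet> A b" for b
  proof -
    \<comment> \<open>The cancellation: lowering \<open>A y\<close> with the metric gives \<xi>'
      back, so the inhomogeneous term of the Christoffel law is exactly the second-derivative term
      in \<alpha>.\<close>
    have "A y \<bullet> (G' (F x) *v B a b) = B a b \<bullet> (G' (F x) *v A y)" by (rule sym)
    also have "\<dots> = \<xi>' \<bullet> B a b"
      unfolding y'[symmetric] matrix_inv_mult_eq(1)[OF det(2)] by (rule inner_commute)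
    moreover have "christoffel G x y a b = christoffel G' (F x) (A y) (A a) (A b) + A y \<bullet> (G' (F x) *v B a b)"
      unfolding A_def B_def by (rule christoffel_transform[OF V F G G' eq sym])
    ultimately show ?thesis
      by (simp add: inner_diff_left christoffel_covector_inner[OF G']
          christoffel_covector_inner[OF smooth_on_differentiable[OF G V(2)]] y' \<alpha> flip: y_def)
  qed
  from raise[OF this] show ?thesis by (simp add: split_def split_frame_def mA)
qed

lemma smooth_on_split:
  assumes U: "open U" and G: "smooth_on U G" and det: "\<And>x. x \<in> U \<Longrightarrow> det (G x) \<noteq> 0"
  shows "smooth_on ((U \<times> UNIV) \<times> UNIV) (\<lambda>z. split G z u)"
proof -
  let ?S = "((U \<times> UNIV) \<times> UNIV) :: split_vector set"
  have o: "open ?S" using U by (intro open_Times open_UNIV)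
  have x: "smooth_on ?S (\<lambda>z. fst (fst z))" and \<xi>: "smooth_on ?S (\<lambda>z. snd (fst z))"
    by (intro smooth_on_fst smooth_on_snd smooth_on_ident o)+
  have im: "(\<lambda>z. fst (fst z)) ` ?S \<subseteq> U" by auto
  have Gz: "smooth_on ?S (\<lambda>z. G (fst (fst z)))" by (rule smooth_on_compose[OF G o x im])
  have y: "smooth_on ?S (\<lambda>z. matrix_inv (G (fst (fst z))) *v snd (fst z))"
    by (rule smooth_on_matrix_inv_mult[OF o Gz \<xi>]) (use det in auto)
  have D: "smooth_on ?S (\<lambda>z. frechet_derivative G (at (fst (fst z))) (v z))" if "smooth_on ?S v" for v
    by (rule smooth_on_frechet_derivative_apply[OF G o x im that])
  have \<Gamma>: "smooth_on ?S (\<lambda>z. christoffel_covector G (fst (fst z)) (snd (fst z)) a)" for a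
    unfolding christoffel_covector_def christoffel_def
    by (intro smooth_intros o y D) simp_all
  show ?thesis
    unfolding split_def
    by (intro smooth_on_Pair smooth_on_const o smooth_on_matrix_inv_mult Gz smooth_on_diff \<Gamma>) (use det in auto)
qed

lemma smooth_on_g2_form:
  assumes "open S" "smooth_on S M" "smooth_on S \<sigma>" "smooth_on S u" "smooth_on S v" "smooth_on S w"
  shows "smooth_on S (\<lambda>z. g2_form (M z) (\<sigma> z) (u z) (v z) (w z))"
  unfolding g2_form_def pairing_def triple_def
  by (intro smooth_on_add smooth_on_diff smooth_on_mult smooth_on_inner smooth_on_matrix_vector_mult smooth_on_cross3
      smooth_on_fst smooth_on_snd assms)

section \<open>The form on the bundle\<close>

locale oriented_riemannian_3_manifold =
  fixes X :: "('a, real ^ 3) manifold"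
    and Q :: "('a, real ^ 3) chart set"
    and g :: "'a \<Rightarrow> ('a, real ^ 3) tangent \<Rightarrow> ('a, real ^ 3) tangent \<Rightarrow> real"
  assumes manifold_X: "smooth_manifold X"
    and orientation_Q: "orientation X Q"
    and metric_g: "riemannian_metric X g"
begin

lemma at: "smooth_atlas (points X) (atlas X)"
  using manifold_X by (simp add: smooth_manifold_def)

lemmas chart = atlas_is_chart[OF at]
  and compat = atlas_compatible[OF at]
  and transition_chart = transition_apply[OF atlas_is_chart[OF at]]
  and chart_inv = chart_inv_left[OF atlas_is_chart[OF at]]

lemma charts_atI: "c \<in> atlas X \<Longrightarrow> p \<in> fst c \<Longrightarrow> c \<in> charts_at X p"
  by (simp add: charts_at_def)

lemma open_chart_image: "c \<in> atlas X \<Longrightarrow> open (snd c ` fst c)"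
  using chart by (auto simp only: is_chart_def)

lemma chart_domain_subset: "c \<in> atlas X \<Longrightarrow> p \<in> fst c \<Longrightarrow> p \<in> points X"
  using chart unfolding is_chart_def by blast

section \<open>The metric in coordinates\<close>

definition metric_matrix :: "('a, real ^ 3) chart \<Rightarrow> real ^ 3 \<Rightarrow> real ^ 3 ^ 3" where
  "metric_matrix c x = (\<chi> i j. g (chart_inv c x) (coord_vector X c (chart_inv c x) (axis i 1))
                                   (coord_vector X c (chart_inv c x) (axis j 1)))"

lemma g_symmetric: "p \<in> points X \<Longrightarrow> u \<in> tangent_space X p \<Longrightarrow> v \<in> tangent_space X p \<Longrightarrow> g p u v = g p v u"
  and g_positive: "p \<in> points X \<Longrightarrow> v \<in> tangent_space X p \<Longrightarrow> v \<noteq> (\<lambda>_. 0) \<Longrightarrow> g p v v > 0"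
  and g_linear: "p \<in> points X \<Longrightarrow> v \<in> tangent_space X p \<Longrightarrow> linear_on_tangent X p (g p v)"
  using metric_g unfolding riemannian_metric_def by blast+

lemma metric_matrix_inner:
  assumes c: "c \<in> atlas X" "p \<in> fst c"
  shows "a \<bullet> (metric_matrix c (snd c p) *v b) = g p (coord_vector X c p a) (coord_vector X c p b)"
proof -
  note cp = charts_atI[OF c] and pX = chart_domain_subset[OF c]
  note tang = coord_vector_in_tangent_space[OF at cp]
  let ?h = "\<lambda>a b. g p (coord_vector X c p a) (coord_vector X c p b)"
  have l2: "linear (\<lambda>b. ?h a b)" for a
    by (rule linear_on_tangent_coord[OF at cp g_linear[OF pX tang]])
  have sym: "?h a b = ?h b a" for a b by (rule g_symmetric[OF pX tang tang])
  \<comment> \<open>A Riemannian metric is given as linear in its second argument; linearity in the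
    first comes from symmetry.\<close>
  have l1: "linear (\<lambda>a. ?h a b)" for b using l2[of b] by (simp add: sym[of _ b])
  have "?h a b = ?h (\<Sum>i\<in>UNIV. a $ i *\<^sub>R axis i 1) (\<Sum>j\<in>UNIV. b $ j *\<^sub>R axis j 1)"
    using basis_expansion[of a] basis_expansion[of b] by (simp add: scalar_mult_eq_scaleR)
  also have "\<dots> = (\<Sum>j\<in>UNIV. \<Sum>i\<in>UNIV. a $ i * b $ j * ?h (axis i 1) (axis j 1))"
    by (simp add: linear_sum[OF l1] linear_sum[OF l2] linear_scale[OF l1] linear_scale[OF l2] sum_distrib_left mult_ac)
  also have "\<dots> = (\<Sum>i\<in>UNIV. \<Sum>j\<in>UNIV. a $ i * b $ j * ?h (axis i 1) (axis j 1))"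
    by (rule sum.swap)
  also have "\<dots> = a \<bullet> (metric_matrix c (snd c p) *v b)"
    by (simp add: inner_vec_def matrix_vector_mult_def metric_matrix_def chart_inv[OF c] sum_distrib_left algebra_simps)
  finally show ?thesis by simp
qed

lemma metric_matrix_symmetric:
  assumes c: "c \<in> atlas X" "p \<in> fst c"
  shows "a \<bullet> (metric_matrix c (snd c p) *v b) = b \<bullet> (metric_matrix c (snd c p) *v a)"
  unfolding metric_matrix_inner[OF c]
  by (intro g_symmetric chart_domain_subset[OF c] coord_vector_in_tangent_space[OF at charts_atI[OF c]])

lemma metric_matrix_positive:
  assumes c: "c \<in> atlas X" "p \<in> fst c" and "a \<noteq> 0"
  shows "a \<bullet> (metric_matrix c (snd c p) *v a) > 0"
  unfolding metric_matrix_inner[OF c]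
proof (intro g_positive chart_domain_subset[OF c] coord_vector_in_tangent_space[OF at charts_atI[OF c]] notI)
  assume "coord_vector X c p a = (\<lambda>_. 0)"
  then show False using coord_vector_self[OF at charts_atI[OF c], of a] \<open>a \<noteq> 0\<close> by simp
qed

lemma det_metric_matrix:
  assumes c: "c \<in> atlas X" "p \<in> fst c"
  shows "det (metric_matrix c (snd c p)) > 0"
  by (rule det_pos_of_form_pos[OF metric_matrix_positive[OF c] metric_matrix_symmetric[OF c]])

lemma det_metric_matrix_image: "c \<in> atlas X \<Longrightarrow> x \<in> snd c ` fst c \<Longrightarrow> det (metric_matrix c x) > 0"
  using det_metric_matrix by blast

lemma smooth_on_metric_matrix:
  assumes c: "c \<in> atlas X"
  shows "smooth_on (snd c ` fst c) (metric_matrix c)"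
  unfolding metric_matrix_def
proof (intro smooth_on_vec_lambda open_chart_image[OF c])
  show "smooth_on (snd c ` fst c) (\<lambda>x. g (chart_inv c x) (coord_vector X c (chart_inv c x) (axis i 1))
      (coord_vector X c (chart_inv c x) (axis j 1)))" for i j
    using metric_g c unfolding riemannian_metric_def Let_def by blast
qed

lemma metric_matrix_change:
  assumes c: "c \<in> atlas X" "p \<in> fst c" and d: "d \<in> atlas X" "p \<in> fst d"
  shows "a \<bullet> (metric_matrix c (snd c p) *v b) =
    frechet_derivative (transition c d) (at (snd c p)) a \<bullet>
      (metric_matrix d (snd d p) *v frechet_derivative (transition c d) (at (snd c p)) b)"
  unfolding metric_matrix_inner[OF c] metric_matrix_inner[OF d]
    coord_vector_change[OF at charts_atI[OF c] charts_atI[OF d], symmetric] ..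

section \<open>Orientation and the signed volume density\<close>

abbreviation jacobian :: "('a, real ^ 3) chart \<Rightarrow> ('a, real ^ 3) chart \<Rightarrow> real ^ 3 \<Rightarrow> real ^ 3 ^ 3" where
  "jacobian c d x \<equiv> matrix (frechet_derivative (transition c d) (at x))"

lemma jacobian_works:
  assumes "compatible c d" "p \<in> fst c" "p \<in> fst d"
  shows "jacobian c d (snd c p) *v v = frechet_derivative (transition c d) (at (snd c p)) v"
  using transition_has_derivative(2)[OF assms(1)] assms(2,3) by (simp add: matrix_works)

lemma metric_matrix_jacobian:
  assumes c: "c \<in> atlas X" "p \<in> fst c" and d: "d \<in> atlas X" "p \<in> fst d"
  shows "metric_matrix c (snd c p) =
    transpose (jacobian c d (snd c p)) ** metric_matrix d (snd d p) ** jacobian c d (snd c p)"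
proof -
  have "metric_matrix c (snd c p) $ i $ j =
    (transpose (jacobian c d (snd c p)) ** metric_matrix d (snd d p) ** jacobian c d (snd c p)) $ i $ j" for i j
    unfolding matrix_entry_inner matrix_vector_mul_assoc[symmetric] inner_transpose_mult
      jacobian_works[OF compat[OF c(1) d(1)] c(2) d(2)] by (rule metric_matrix_change[OF c d])
  then show ?thesis by (simp add: vec_eq_iff)
qed

text \<open>An arbitrary choice. It enters the form only through the sign of a Jacobian determinant,
  which is the same for all charts of \<open>Q\<close> by \<open>sgn_det_jacobian_Q\<close>.\<close>

definition orienting_chart :: "'a \<Rightarrow> ('a, real ^ 3) chart" where
  "orienting_chart p = (SOME q. q \<in> Q \<and> p \<in> fst q)"

lemma orienting_chart: "p \<in> points X \<Longrightarrow> orienting_chart p \<in> Q" "p \<in> points X \<Longrightarrow> p \<in> fst (orienting_chart p)"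
proof -
  assume "p \<in> points X"
  then have "\<exists>q. q \<in> Q \<and> p \<in> fst q" using orientation_Q unfolding orientation_def by blast
  from someI_ex[OF this] show "orienting_chart p \<in> Q" "p \<in> fst (orienting_chart p)"
    unfolding orienting_chart_def by blast+
qed

lemma Q_chart: "q \<in> Q \<Longrightarrow> is_chart (points X) q"
  and Q_compat: "q \<in> Q \<Longrightarrow> c \<in> atlas X \<Longrightarrow> compatible q c"
  using orientation_Q unfolding orientation_def smooth_charts_def by blast+

lemma Q_compat': "q \<in> Q \<Longrightarrow> c \<in> atlas X \<Longrightarrow> compatible c q"
  using Q_compat compatible_sym by blast

lemma Q_positive: "q \<in> Q \<Longrightarrow> q' \<in> Q \<Longrightarrow> p \<in> fst q \<Longrightarrow> p \<in> fst q' \<Longrightarrow> det (jacobian q q' (snd q p)) > 0"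
  using orientation_Q unfolding orientation_def by blast

lemma jacobian_cocycle:
  assumes "is_chart P c" "is_chart P d" "compatible c d" "compatible d e"
    and p: "p \<in> fst c" "p \<in> fst d" "p \<in> fst e"
  shows "jacobian c e (snd c p) = jacobian d e (snd d p) ** jacobian c d (snd c p)"
proof -
  have "frechet_derivative (transition c e) (at (snd c p)) =
      frechet_derivative (transition d e) (at (snd d p)) \<circ> frechet_derivative (transition c d) (at (snd c p))"
    using transition_cocycle[OF assms] by (simp add: fun_eq_iff)
  then show ?thesis
    using matrix_compose[OF transition_has_derivative(2)[OF assms(3), of p] transition_has_derivative(2)[OF assms(4), of p]] p
    by simp
qed

lemma det_jacobian_inverse:
  assumes q: "q \<in> Q" and c: "c \<in> atlas X" and p: "p \<in> fst c" "p \<in> fst q"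
  shows "det (jacobian q c (snd q p)) * det (jacobian c q (snd c p)) = 1"
proof -
  have "jacobian c c (snd c p) = mat 1"
    unfolding transition_self[OF chart[OF c] p(1)] using matrix_id_mat_1 by (simp add: id_def)
  then show ?thesis
    unfolding jacobian_cocycle[OF chart[OF c] Q_chart[OF q] Q_compat'[OF q c] Q_compat[OF q c] p p(1)]
    by (simp only: det_mul[symmetric] det_I)
qed

lemma sgn_det_jacobian_Q:
  assumes q: "q \<in> Q" "p \<in> fst q" and q': "q' \<in> Q" "p \<in> fst q'" and c: "c \<in> atlas X" "p \<in> fst c"
  shows "sgn (det (jacobian c q' (snd c p))) = sgn (det (jacobian c q (snd c p)))"
proof -
  \<comment> \<open>Charts of \<open>Q\<close> are known to be compatible with the atlas, so the
    change from \<open>q\<close> to \<open>q'\<close> is factored through \<open>c\<close>.\<close>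
  have "det (jacobian q q' (snd q p)) = det (jacobian c q' (snd c p)) * det (jacobian q c (snd q p))"
    unfolding jacobian_cocycle[OF Q_chart[OF q(1)] chart[OF c(1)] Q_compat[OF q(1) c(1)] Q_compat'[OF q'(1) c(1)]
      q(2) c(2) q'(2)] by (rule det_mul)
  then have eq: "det (jacobian q q' (snd q p)) * det (jacobian c q (snd c p)) = det (jacobian c q' (snd c p))"
    using det_jacobian_inverse[OF q(1) c(1) c(2) q(2)] by (simp add: mult.assoc)
  then show ?thesis using Q_positive[OF q(1) q'(1) q(2) q'(2)] by (simp add: sgn_mult eq[symmetric])
qed

text \<open>The coefficient of the oriented Riemannian volume form in the chart \<open>c\<close>; it
  is negative where \<open>c\<close> reverses the orientation.\<close>

definition volume_density :: "('a, real ^ 3) chart \<Rightarrow> real ^ 3 \<Rightarrow> real" where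
  "volume_density c x =
     sgn (det (jacobian c (orienting_chart (chart_inv c x)) x)) * sqrt (det (metric_matrix c x))"

text \<open>The square root contributes the absolute value of the Jacobian determinant and the
  orientation sign contributes its sign. The density thus transforms like the coefficient of a
  top-degree form.\<close>

lemma volume_density_change:
  assumes c: "c \<in> atlas X" "p \<in> fst c" and d: "d \<in> atlas X" "p \<in> fst d"
  shows "volume_density c (snd c p) = volume_density d (snd d p) * det (jacobian c d (snd c p))"
proof -
  let ?q = "orienting_chart p" and ?J = "det (jacobian c d (snd c p))"
  have q: "?q \<in> Q" "p \<in> fst ?q" using orienting_chart chart_domain_subset[OF c] by blast+
  have "det (metric_matrix c (snd c p)) = ?J\<^sup>2 * det (metric_matrix d (snd d p))"
    unfolding metric_matrix_jacobian[OF c d] by (simp add: det_mul power2_eq_square)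
  then have "sqrt (det (metric_matrix c (snd c p))) = \<bar>?J\<bar> * sqrt (det (metric_matrix d (snd d p)))"
    by (simp add: real_sqrt_mult)
  moreover have "det (jacobian c ?q (snd c p)) = det (jacobian d ?q (snd d p)) * ?J"
    unfolding jacobian_cocycle[OF chart[OF c(1)] chart[OF d(1)] compat[OF c(1) d(1)] Q_compat'[OF q(1) d(1)] c(2) d(2) q(2)]
    by (simp add: det_mul)
  moreover have "sgn ?J * \<bar>?J\<bar> = ?J" by (simp add: sgn_mult_abs)
  ultimately show ?thesis
    unfolding volume_density_def chart_inv[OF c] chart_inv[OF d] by (simp add: sgn_mult algebra_simps)
qed

text \<open>The orienting chart is chosen separately at every point, with no continuity. Near a
  given point a single chart of \<open>Q\<close> gives the same signs, which makes the smooth local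
  formula available.\<close>

lemma smooth_on_volume_density:
  assumes c: "c \<in> atlas X"
  shows "smooth_on (snd c ` fst c) (volume_density c)"
proof (rule smooth_on_local)
  fix x assume "x \<in> snd c ` fst c"
  then obtain p where p: "p \<in> fst c" "x = snd c p" by blast
  let ?q = "orienting_chart p"
  have q: "?q \<in> Q" "p \<in> fst ?q" using orienting_chart chart_domain_subset[OF c p(1)] by blast+
  let ?V = "snd c ` (fst c \<inter> fst ?q)"
  define h where "h y = det (jacobian c ?q y)" for y
  have V: "open ?V" by (rule compatible_smooth(2)[OF Q_compat'[OF q(1) c]])
  have G: "smooth_on ?V (metric_matrix c)" by (rule smooth_on_subset[OF smooth_on_metric_matrix[OF c]]) blast
  have h0: "h y \<noteq> 0" if yV: "y \<in> ?V" for y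
  proof -
    obtain r where "r \<in> fst c" "r \<in> fst ?q" "y = snd c r" using yV by blast
    then show ?thesis using det_jacobian_inverse[OF q(1) c, of r] unfolding h_def by (metis mult_zero_right zero_neq_one)
  qed
  have "smooth_on ?V (\<lambda>y. jacobian c ?q y $ i $ j)" for i j
    unfolding matrix_def
    using smooth_on_vec_nth[OF V smooth_on_frechet_derivative[OF compatible_smooth(1)[OF Q_compat'[OF q(1) c]]]] by simp
  then have hs: "smooth_on ?V h" unfolding h_def by (intro smooth_on_det V)
  have "smooth_on ?V (volume_density c)"
  proof (rule smooth_on_cong[OF V])
    \<comment> \<open>Writes the sign of \<open>h\<close> as a smooth expression, valid because
      \<open>h\<close> has no zero on this set.\<close>
    show "smooth_on ?V (\<lambda>y. h y / sqrt (h y * h y) * sqrt (det (metric_matrix c y)))"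
    proof (intro smooth_on_mult smooth_on_divide smooth_on_sqrt smooth_on_det V hs)
      show "smooth_on ?V (\<lambda>x. metric_matrix c x $ i $ j)" for i j
        by (intro smooth_on_vec_nth V G)
      show "h y * h y > 0" if "y \<in> ?V" for y
        using h0[OF that] by (metis not_real_square_gt_zero)
      show "sqrt (h y * h y) \<noteq> 0" if "y \<in> ?V" for y using h0[OF that] by simp
      show "det (metric_matrix c y) > 0" if "y \<in> ?V" for y
        by (rule det_metric_matrix_image[OF c]) (use that in blast)
    qed
    fix y assume "y \<in> ?V"
    then obtain r where r: "r \<in> fst c" "r \<in> fst ?q" "y = snd c r" by blast
    let ?q' = "orienting_chart r"
    have q': "?q' \<in> Q" "r \<in> fst ?q'" using orienting_chart chart_domain_subset[OF c r(1)] by blast+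
    have "sgn (det (jacobian c ?q' y)) = sgn (h y)"
      unfolding r(3) h_def by (rule sgn_det_jacobian_Q[OF q(1) r(2) q' c r(1)])
    also have "\<dots> = h y / sqrt (h y * h y)"
      by (simp add: sgn_real_def real_sqrt_mult_self abs_if)
    finally show "h y / sqrt (h y * h y) * sqrt (det (metric_matrix c y)) = volume_density c y"
      unfolding volume_density_def r(3) chart_inv[OF c r(1)] by simp
  qed
  then show "\<exists>T. open T \<and> x \<in> T \<and> smooth_on T (volume_density c)"
    using V p q by blast
qed

section \<open>Charts of the total space and their transition derivatives\<close>

abbreviation total_space :: "(('a \<times> (('a, real ^ 3) tangent \<Rightarrow> real)) \<times> real, ((real ^ 3) \<times> (real ^ 3)) \<times> real) manifold" where
  "total_space \<equiv> product_manifold (cotangent_bundle X) euclidean_manifold"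

definition bundle_chart ::
  "('a, real ^ 3) chart \<Rightarrow> (('a \<times> (('a, real ^ 3) tangent \<Rightarrow> real)) \<times> real, ((real ^ 3) \<times> (real ^ 3)) \<times> real) chart" where
  "bundle_chart c = prod_chart (cotangent_chart X c) (UNIV, id)"

lemma smooth_manifold_bundle: "smooth_manifold total_space"
  by (intro smooth_manifold_product smooth_manifold_cotangent_bundle manifold_X smooth_manifold_euclidean)

lemma bundle_at: "smooth_atlas (points total_space) (atlas total_space)"
  using smooth_manifold_bundle by (simp add: smooth_manifold_def)

text \<open>The line has a single chart, so the charts of the total space are indexed by those of
  \<open>X\<close>.\<close>

lemma atlas_bundle: "atlas total_space = bundle_chart ` atlas X"
proof (intro set_eqI iffI)
  fix K assume "K \<in> atlas total_space"
  then obtain c d where K: "K = prod_chart c d" and c: "c \<in> atlas (cotangent_bundle X)"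
    and d: "d \<in> atlas (euclidean_manifold :: (real, real) manifold)"
    unfolding atlas_product_manifold mem_Collect_eq by (elim exE conjE)
  have "d = (UNIV, id)" using d by (simp add: euclidean_manifold_def)
  moreover obtain c' where "c' \<in> atlas X" "c = cotangent_chart X c'"
    using c unfolding cotangent_bundle_def manifold.simps by (elim imageE)
  ultimately show "K \<in> bundle_chart ` atlas X" unfolding K bundle_chart_def by (intro image_eqI) simp_all
next
  fix K assume "K \<in> bundle_chart ` atlas X"
  then obtain c where c: "c \<in> atlas X" "K = bundle_chart c" by (elim imageE)
  have base: "cotangent_chart X c \<in> atlas (cotangent_bundle X)"
    unfolding cotangent_bundle_def manifold.simps using c(1) by (rule imageI)
  have line: "(UNIV, id) \<in> atlas (euclidean_manifold :: (real, real) manifold)"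
    by (simp add: euclidean_manifold_def)
  show "K \<in> atlas total_space"
    unfolding atlas_product_manifold mem_Collect_eq c(2) bundle_chart_def
    by (rule exI[of _ "cotangent_chart X c"], rule exI[of _ "(UNIV, id)"]) (intro conjI refl base line)
qed

lemma bundle_chart_domain:
  "P \<in> fst (bundle_chart c) \<longleftrightarrow> fst (fst P) \<in> fst c \<and> snd (fst P) \<in> cotangent_space X (fst (fst P))"
  by (cases P) (auto simp: bundle_chart_def prod_chart_simps cotangent_chart_simps[OF at])

lemma bundle_chart_apply:
  "snd (bundle_chart c) P = ((snd c (fst (fst P)), covector_coords X c (fst (fst P)) (snd (fst P))), snd P)"
  by (simp add: bundle_chart_def prod_chart_simps cotangent_chart_simps[OF at])

lemma bundle_chart_image:
  assumes "c \<in> atlas X"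
  shows "snd (bundle_chart c) ` fst (bundle_chart c) = (snd c ` fst c \<times> UNIV) \<times> UNIV"
  unfolding bundle_chart_def prod_chart_simps(1) image_prod_chart cotangent_chart_simps(1)[OF at]
    image_cotangent_chart[OF at assms order_refl] by simp

lemma bundle_charts_at:
  assumes "c \<in> atlas X" "P \<in> fst (bundle_chart c)"
  shows "bundle_chart c \<in> charts_at total_space P"
  using assms by (auto simp: charts_at_def atlas_bundle)

lemma bundle_point_chart:
  assumes "P \<in> points total_space"
  obtains c where "c \<in> atlas X" "P \<in> fst (bundle_chart c)"
proof -
  have "P \<in> (\<Union>K\<in>atlas total_space. fst K)" using bundle_at assms unfolding smooth_atlas_def by simp
  then show ?thesis unfolding atlas_bundle using that by blast
qed

text \<open>Differentiating an explicit covector component would involve the derivative of an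
  inverse Jacobian. Instead the adjoint relation between old and new covector coordinates is
  differentiated, which gives precisely the assumption on \<alpha> in
  \<open>split_transform\<close>.\<close>

lemma bundle_transition_derivative:
  assumes c: "c \<in> atlas X" "P \<in> fst (bundle_chart c)" and d: "d \<in> atlas X" "P \<in> fst (bundle_chart d)"
  defines "p \<equiv> fst (fst P)"
    and "T' \<equiv> frechet_derivative (transition (bundle_chart c) (bundle_chart d)) (at (snd (bundle_chart c) P))"
  shows "fst (fst (T' u)) = frechet_derivative (transition c d) (at (snd c p)) (fst (fst u))"
    "snd (T' u) = snd u"
    "snd (fst u) \<bullet> b = snd (fst (T' u)) \<bullet> frechet_derivative (transition c d) (at (snd c p)) b
      + covector_coords X d p (snd (fst P)) \<bullet>
        frechet_derivative (\<lambda>x. frechet_derivative (transition c d) (at x) b) (at (snd c p)) (fst (fst u))"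
proof -
  let ?C = "bundle_chart c" and ?D = "bundle_chart d" and ?F = "transition c d"
  let ?T = "transition ?C ?D" and ?S = "snd ?C ` (fst ?C \<inter> fst ?D)" and ?V = "snd c ` (fst c \<inter> fst d)" and ?z = "snd ?C P"
  have CD: "?C \<in> atlas total_space" "?D \<in> atlas total_space" using c d by (auto simp: atlas_bundle)
  have comp: "compatible ?C ?D" by (rule atlas_compatible[OF bundle_at CD])
  have S: "open ?S" "?z \<in> ?S" using compatible_smooth(2)[OF comp] c d by blast+
  have T': "(?T has_derivative T') (at ?z)"
    unfolding T'_def using transition_has_derivative(1)[OF comp] c d by blast
  have p: "p \<in> fst c" "p \<in> fst d" using c d by (auto simp: bundle_chart_domain p_def)
  have V: "open ?V" "snd c p \<in> ?V" using compatible_smooth(2)[OF compat[OF c(1) d(1)]] p by blast+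
  have F: "smooth_on ?V ?F" by (rule compatible_smooth(1)[OF compat[OF c(1) d(1)]])
  have z: "fst (fst ?z) = snd c p" by (simp add: bundle_chart_apply p_def)
  \<comment> \<open>These relations hold on an open set around the point and describe the transition
    map implicitly.\<close>
  have rel: "?F (fst (fst y)) = fst (fst (?T y))" "snd y = snd (?T y)"
    "snd (fst y) \<bullet> b = snd (fst (?T y)) \<bullet> frechet_derivative ?F (at (fst (fst y))) b" if yS: "y \<in> ?S" for y b
  proof -
    obtain R where R: "R \<in> fst ?C" "R \<in> fst ?D" "y = snd ?C R" using yS by blast
    have T: "?T y = snd ?D R" unfolding R(3) by (rule transition_apply[OF atlas_is_chart[OF bundle_at CD(1)] R(1)])
    have r: "fst (fst R) \<in> fst c" "fst (fst R) \<in> fst d" "snd (fst R) \<in> cotangent_space X (fst (fst R))"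
      using R(1,2) by (simp_all add: bundle_chart_domain)
    show "?F (fst (fst y)) = fst (fst (?T y))" "snd y = snd (?T y)"
      unfolding T unfolding R(3) bundle_chart_apply by (simp_all add: transition_chart[OF c(1) r(1)])
    show "snd (fst y) \<bullet> b = snd (fst (?T y)) \<bullet> frechet_derivative ?F (at (fst (fst y))) b"
      unfolding T unfolding R(3) bundle_chart_apply fst_conv snd_conv
      by (rule covector_coords_change[OF at charts_atI[OF c(1) r(1)] charts_atI[OF d(1) r(2)] r(3)])
  qed
  have base: "((\<lambda>y. fst (fst y)) has_derivative (\<lambda>u. fst (fst u))) (at ?z)"
    by (intro has_derivative_fst has_derivative_ident)
  have chain: "((\<lambda>y. h (fst (fst y))) has_derivative (\<lambda>u. h' (fst (fst u)))) (at ?z)"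
    if "(h has_derivative h') (at (snd c p))" for h :: "real ^ 3 \<Rightarrow> real ^ 3" and h'
    using diff_chain_at[OF base, of h h'] that by (simp add: o_def z)
  have 1: "((\<lambda>y. fst (fst (?T y))) has_derivative (\<lambda>u. frechet_derivative ?F (at (snd c p)) (fst (fst u)))) (at ?z)"
    by (rule has_derivative_transform_within_open[OF chain[OF smooth_on_has_derivative[OF F V(2)]] S rel(1)])
  show "fst (fst (T' u)) = frechet_derivative ?F (at (snd c p)) (fst (fst u))"
    using fun_cong[OF has_derivative_unique[OF has_derivative_fst[OF has_derivative_fst[OF T']] 1]] .
  have 2: "((\<lambda>y. snd (?T y)) has_derivative snd) (at ?z)"
    by (rule has_derivative_transform_within_open[OF has_derivative_snd[OF has_derivative_ident] S rel(2)])
  show "snd (T' u) = snd u"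
    using fun_cong[OF has_derivative_unique[OF has_derivative_snd[OF T'] 2]] .
  have F2: "((\<lambda>y. frechet_derivative ?F (at (fst (fst y))) b) has_derivative
      (\<lambda>u. frechet_derivative (\<lambda>x. frechet_derivative ?F (at x) b) (at (snd c p)) (fst (fst u)))) (at ?z)"
    by (rule chain[OF smooth_on_has_derivative[OF smooth_on_frechet_derivative[OF F] V(2)]])
  \<comment> \<open>The product rule for the right-hand side of the third relation; the left-hand
    side is linear in \<open>y\<close>, and uniqueness of the derivative equates the two
    results.\<close>
  have "((\<lambda>y. snd (fst (?T y)) \<bullet> frechet_derivative ?F (at (fst (fst y))) b) has_derivative
      (\<lambda>u. snd (fst (?T ?z)) \<bullet> frechet_derivative (\<lambda>x. frechet_derivative ?F (at x) b) (at (snd c p)) (fst (fst u))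
         + snd (fst (T' u)) \<bullet> frechet_derivative ?F (at (snd c p)) b)) (at ?z)"
    using has_derivative_inner[OF has_derivative_snd[OF has_derivative_fst[OF T']] F2] by (simp add: z)
  moreover have "((\<lambda>y. snd (fst (?T y)) \<bullet> frechet_derivative ?F (at (fst (fst y))) b) has_derivative
      (\<lambda>u. snd (fst u) \<bullet> b)) (at ?z)"
    by (rule has_derivative_transform_within_open[OF _ S rel(3)])
      (intro has_derivative_inner_left has_derivative_snd has_derivative_fst has_derivative_ident)
  ultimately have "snd (fst u) \<bullet> b = snd (fst (?T ?z)) \<bullet> frechet_derivative (\<lambda>x. frechet_derivative ?F (at x) b) (at (snd c p)) (fst (fst u))
         + snd (fst (T' u)) \<bullet> frechet_derivative ?F (at (snd c p)) b"
    by (rule fun_cong[OF has_derivative_unique, symmetric])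
  moreover have "?T ?z = snd ?D P" by (rule transition_apply[OF atlas_is_chart[OF bundle_at CD(1)] c(2)])
  ultimately show "snd (fst u) \<bullet> b = snd (fst (T' u)) \<bullet> frechet_derivative ?F (at (snd c p)) b
      + covector_coords X d p (snd (fst P)) \<bullet>
        frechet_derivative (\<lambda>x. frechet_derivative ?F (at x) b) (at (snd c p)) (fst (fst u))"
    by (simp add: bundle_chart_apply p_def)
qed

section \<open>The three-form and its adapted frames\<close>

definition phi_coord :: "('a, real ^ 3) chart \<Rightarrow> split_vector \<Rightarrow> split_vector \<Rightarrow> split_vector \<Rightarrow> split_vector \<Rightarrow> real" where
  "phi_coord c z u v w = g2_form (metric_matrix c (fst (fst z))) (volume_density c (fst (fst z)))
     (split (metric_matrix c) z u) (split (metric_matrix c) z v) (split (metric_matrix c) z w)"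

lemma differentiable_metric_matrix:
  assumes "c \<in> atlas X" "p \<in> fst c"
  shows "metric_matrix c differentiable (at (snd c p))"
  using smooth_on_differentiable[OF smooth_on_metric_matrix] assms by blast

lemma split_bundle_transition:
  assumes c: "c \<in> atlas X" "P \<in> fst (bundle_chart c)" and d: "d \<in> atlas X" "P \<in> fst (bundle_chart d)"
  shows "split (metric_matrix d) (snd (bundle_chart d) P)
      (frechet_derivative (transition (bundle_chart c) (bundle_chart d)) (at (snd (bundle_chart c) P)) u)
    = split_frame (jacobian c d (snd c (fst (fst P)))) (split (metric_matrix c) (snd (bundle_chart c) P) u)"
proof -
  let ?p = "fst (fst P)" and ?F = "transition c d" and ?V = "snd c ` (fst c \<inter> fst d)"
  let ?x = "snd c ?p"
  let ?T' = "frechet_derivative (transition (bundle_chart c) (bundle_chart d)) (at (snd (bundle_chart c) P))"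
  have p: "?p \<in> fst c" "?p \<in> fst d" "snd (fst P) \<in> cotangent_space X ?p" using c d by (auto simp: bundle_chart_domain)
  have V: "open ?V" "?x \<in> ?V" using compatible_smooth(2)[OF compat[OF c(1) d(1)]] p by blast+
  have F: "smooth_on ?V ?F" by (rule compatible_smooth(1)[OF compat[OF c(1) d(1)]])
  have G: "smooth_on ?V (metric_matrix c)" by (rule smooth_on_subset[OF smooth_on_metric_matrix[OF c(1)]]) blast
  have Fx: "?F ?x = snd d ?p" by (rule transition_chart[OF c(1) p(1)])
  note T' = bundle_transition_derivative[OF c d]
  have u: "?T' u = ((frechet_derivative ?F (at ?x) (fst (fst u)), snd (fst (?T' u))), snd u)"
    using T'(1,2)[of u] by (simp add: prod_eq_iff)
  have "split (metric_matrix d) ((?F ?x, covector_coords X d ?p (snd (fst P))), snd P)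
        ((frechet_derivative ?F (at ?x) (fst (fst u)), snd (fst (?T' u))), snd u)
     = split_frame (jacobian c d ?x)
        (split (metric_matrix c) ((?x, covector_coords X c ?p (snd (fst P))), snd P) ((fst (fst u), snd (fst u)), snd u))"
  proof (rule split_transform[OF V F G])
    show "metric_matrix d differentiable (at (?F ?x))"
      unfolding Fx by (rule differentiable_metric_matrix[OF d(1) p(2)])
    show "a \<bullet> (metric_matrix c y *v b) = frechet_derivative ?F (at y) a \<bullet> (metric_matrix d (?F y) *v frechet_derivative ?F (at y) b)"
      if yV: "y \<in> ?V" for y a b
    proof -
      obtain r where r: "r \<in> fst c" "r \<in> fst d" "y = snd c r" using yV by blast
      show ?thesis unfolding r(3) transition_chart[OF c(1) r(1)] by (rule metric_matrix_change[OF c(1) r(1) d(1) r(2)])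
    qed
    show "a \<bullet> (metric_matrix d (?F ?x) *v b) = b \<bullet> (metric_matrix d (?F ?x) *v a)" for a b
      unfolding Fx by (rule metric_matrix_symmetric[OF d(1) p(2)])
    show "det (metric_matrix c ?x) \<noteq> 0" "det (metric_matrix d (?F ?x)) \<noteq> 0"
      unfolding Fx using det_metric_matrix[OF c(1) p(1)] det_metric_matrix[OF d(1) p(2)] by simp_all
    show "covector_coords X c ?p (snd (fst P)) \<bullet> b = covector_coords X d ?p (snd (fst P)) \<bullet> frechet_derivative ?F (at ?x) b" for b
      by (rule covector_coords_change[OF at charts_atI[OF c(1) p(1)] charts_atI[OF d(1) p(2)] p(3)])
    show "snd (fst u) \<bullet> b = snd (fst (?T' u)) \<bullet> frechet_derivative ?F (at ?x) b + covector_coords X d ?p (snd (fst P)) \<bullet>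
        frechet_derivative (\<lambda>x. frechet_derivative ?F (at x) b) (at ?x) (fst (fst u))" for b
      by (rule T'(3))
  qed
  then show ?thesis unfolding Fx u[symmetric] by (simp add: bundle_chart_apply)
qed

text \<open>The split vectors change by the complexified Jacobian, the metric by congruence and the
  density by the determinant; \<open>g2_form_frame\<close> says that these three changes compensate
  each other.\<close>

lemma phi_coord_change:
  assumes c: "c \<in> atlas X" "P \<in> fst (bundle_chart c)" and d: "d \<in> atlas X" "P \<in> fst (bundle_chart d)"
    and u: "u \<in> tangent_space total_space P" and v: "v \<in> tangent_space total_space P" and w: "w \<in> tangent_space total_space P"
  shows "phi_coord c (snd (bundle_chart c) P) (u (bundle_chart c)) (v (bundle_chart c)) (w (bundle_chart c))
       = phi_coord d (snd (bundle_chart d) P) (u (bundle_chart d)) (v (bundle_chart d)) (w (bundle_chart d))"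
proof -
  let ?p = "fst (fst P)"
  have p: "?p \<in> fst c" "?p \<in> fst d" using c d by (auto simp: bundle_chart_domain)
  have z: "fst (fst (snd (bundle_chart e) P)) = snd e ?p" for e by (simp add: bundle_chart_apply)
  have tr: "split (metric_matrix d) (snd (bundle_chart d) P) (t (bundle_chart d))
      = split_frame (jacobian c d (snd c ?p)) (split (metric_matrix c) (snd (bundle_chart c) P) (t (bundle_chart c)))"
    if "t \<in> tangent_space total_space P" for t
    unfolding tangent_transform[OF bundle_at that bundle_charts_at[OF c] bundle_charts_at[OF d]]
    by (rule split_bundle_transition[OF c d])
  show ?thesis
    unfolding phi_coord_def z tr[OF u] tr[OF v] tr[OF w] g2_form_frame
      metric_matrix_jacobian[OF c(1) p(1) d(1) p(2), symmetric] volume_density_change[OF c(1) p(1) d(1) p(2), symmetric] ..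
qed

text \<open>The chart is an arbitrary choice, which \<open>phi_eq\<close> removes for arguments in
  the tangent space.\<close>

definition phi where
  "phi P u v w = (let c = SOME c. c \<in> atlas X \<and> P \<in> fst (bundle_chart c); C = bundle_chart c
     in phi_coord c (snd C P) (u C) (v C) (w C))"

lemma phi_eq:
  assumes "c \<in> atlas X" "P \<in> fst (bundle_chart c)"
    and "u \<in> tangent_space total_space P" "v \<in> tangent_space total_space P" "w \<in> tangent_space total_space P"
  shows "phi P u v w = phi_coord c (snd (bundle_chart c) P) (u (bundle_chart c)) (v (bundle_chart c)) (w (bundle_chart c))"
proof -
  let ?d = "SOME c. c \<in> atlas X \<and> P \<in> fst (bundle_chart c)"
  have "?d \<in> atlas X \<and> P \<in> fst (bundle_chart ?d)"
    by (rule someI[of "\<lambda>c. c \<in> atlas X \<and> P \<in> fst (bundle_chart c)" c]) (use assms in blast)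
  then show ?thesis
    unfolding phi_def Let_def using phi_coord_change[of ?d P c] assms by blast
qed

lemma linear_phi_coord:
  assumes "metric_matrix c differentiable (at (fst (fst z)))"
  shows "linear (\<lambda>u. phi_coord c z u v w)" "linear (\<lambda>u. phi_coord c z v u w)" "linear (\<lambda>u. phi_coord c z v w u)"
proof -
  note l = linear_split(1)[of "metric_matrix c" z, OF assms]
  show "linear (\<lambda>u. phi_coord c z u v w)" "linear (\<lambda>u. phi_coord c z v u w)" "linear (\<lambda>u. phi_coord c z v w u)"
    unfolding phi_coord_def
    using linear_compose[OF l linear_g2_form(1)] linear_compose[OF l linear_g2_form(2)] linear_compose[OF l linear_g2_form(3)]
    by (simp_all add: o_def)
qed

lemma linear_on_tangentI:
  assumes C: "C \<in> charts_at total_space P" and l: "linear f"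
    and eq: "\<And>u. u \<in> tangent_space total_space P \<Longrightarrow> \<xi> u = f (u C)"
  shows "linear_on_tangent total_space P \<xi>"
  unfolding linear_on_tangent_def
  using eq tangent_add_in[OF bundle_at] tangent_scale_in[OF bundle_at] linear_add[OF l] linear_scale[OF l]
  by (simp add: tangent_add_def tangent_scale_def)

lemma three_form_phi: "three_form total_space phi"
  unfolding three_form_def
proof (intro conjI ballI allI)
  fix P u v
  assume P: "P \<in> points total_space" and u: "u \<in> tangent_space total_space P" and v: "v \<in> tangent_space total_space P"
  obtain c where c: "c \<in> atlas X" "P \<in> fst (bundle_chart c)" using bundle_point_chart[OF P] .
  note C = bundle_charts_at[OF c]
  have "fst (fst (snd (bundle_chart c) P)) = snd c (fst (fst P))" by (simp add: bundle_chart_apply)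
  then have d: "metric_matrix c differentiable (at (fst (fst (snd (bundle_chart c) P))))"
    using differentiable_metric_matrix[OF c(1)] c(2) by (simp add: bundle_chart_domain)
  note l = linear_phi_coord[of c "snd (bundle_chart c) P", OF d]
  show "linear_on_tangent total_space P (\<lambda>w. phi P w u v)"
    by (rule linear_on_tangentI[OF C l(1)[of "u (bundle_chart c)" "v (bundle_chart c)"]]) (rule phi_eq[OF c _ u v])
  show "linear_on_tangent total_space P (\<lambda>w. phi P u w v)"
    by (rule linear_on_tangentI[OF C l(2)[of "u (bundle_chart c)" "v (bundle_chart c)"]]) (rule phi_eq[OF c u _ v])
  show "linear_on_tangent total_space P (\<lambda>w. phi P u v w)"
    by (rule linear_on_tangentI[OF C l(3)[of "u (bundle_chart c)" "v (bundle_chart c)"]]) (rule phi_eq[OF c u v])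
  show "phi P u u v = 0" "phi P u v u = 0" "phi P v u u = 0"
    by (simp_all add: phi_eq[OF c] u v phi_coord_def g2_form_alternating)
next
  fix C a b e
  assume "C \<in> atlas total_space"
  then obtain c where c: "c \<in> atlas X" and C: "C = bundle_chart c" unfolding atlas_bundle by blast
  let ?U = "snd c ` fst c"
  let ?S = "(?U \<times> UNIV) \<times> UNIV :: split_vector set"
  have S: "open ?S" using open_chart_image[OF c] by (intro open_Times open_UNIV)
  have x: "smooth_on ?S (\<lambda>z. fst (fst z))" by (intro smooth_on_fst smooth_on_ident S)
  have im: "(\<lambda>z. fst (fst z)) ` ?S \<subseteq> ?U" by auto
  have split: "smooth_on ?S (\<lambda>z. split (metric_matrix c) z u)" for u
    by (rule smooth_on_split[OF open_chart_image[OF c] smooth_on_metric_matrix[OF c]])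
      (use det_metric_matrix_image[OF c] in force)
  \<comment> \<open>The coordinate vectors of \<open>bundle_chart c\<close> have constant components
    in that chart, so in coordinates only the point \<open>z\<close> varies.\<close>
  have "smooth_on ?S (\<lambda>z. phi_coord c z a b e)"
    unfolding phi_coord_def
    by (intro smooth_on_g2_form S split smooth_on_compose[OF smooth_on_metric_matrix[OF c] S x im]
        smooth_on_compose[OF smooth_on_volume_density[OF c] S x im])
  then show "smooth_on (snd C ` fst C) (\<lambda>x. let P = chart_inv C x in
      phi P (coord_vector total_space C P a) (coord_vector total_space C P b) (coord_vector total_space C P e))"
    unfolding C bundle_chart_image[OF c]
  proof (rule smooth_on_cong[OF S])
    fix z assume "z \<in> ?S"
    then have z: "z \<in> snd (bundle_chart c) ` fst (bundle_chart c)" unfolding bundle_chart_image[OF c] .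
    let ?P = "chart_inv (bundle_chart c) z"
    have P: "?P \<in> fst (bundle_chart c)" by (rule chart_inv_in[OF z])
    note CP = bundle_charts_at[OF c P]
    show "phi_coord c z a b e = (let P = ?P in phi P (coord_vector total_space (bundle_chart c) P a)
        (coord_vector total_space (bundle_chart c) P b) (coord_vector total_space (bundle_chart c) P e))"
      unfolding Let_def
      by (simp only: phi_eq[OF c P] coord_vector_in_tangent_space[OF bundle_at CP] coord_vector_self[OF bundle_at CP]
          chart_inv_right[OF z])
  qed
qed

lemma phi_standard:
  assumes P: "P \<in> points total_space"
  shows "\<exists>L. tangent_iso total_space P L \<and> (\<forall>u v w. phi P (L u) (L v) (L w) = phi0 u v w)"
proof -
  obtain c where c: "c \<in> atlas X" "P \<in> fst (bundle_chart c)" using bundle_point_chart[OF P] .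
  note C = bundle_charts_at[OF c]
  let ?p = "fst (fst P)" and ?z = "snd (bundle_chart c) P" and ?G = "metric_matrix c"
  let ?M = "?G (snd c ?p)" and ?\<sigma> = "volume_density c (snd c ?p)"
  have p: "?p \<in> fst c" using c by (simp add: bundle_chart_domain)
  have z: "fst (fst ?z) = snd c ?p" by (simp add: bundle_chart_apply)
  have q: "orienting_chart ?p \<in> Q" "?p \<in> fst (orienting_chart ?p)"
    using orienting_chart chart_domain_subset[OF c(1) p] by blast+
  let ?s = "sgn (det (jacobian c (orienting_chart ?p) (snd c ?p)))"
  \<comment> \<open>The Jacobian is invertible, so its determinant has a nonzero sign.\<close>
  have "\<bar>?s\<bar> = 1" using det_jacobian_inverse[OF q(1) c(1) p q(2)] by (auto simp: abs_sgn_eq)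
  then obtain A where A: "transpose A ** ?M ** A = mat 1" "?s * sqrt (det ?M) * det A = 1"
    using exists_oriented_orthonormal_frame[OF metric_matrix_positive[OF c(1) p] metric_matrix_symmetric[OF c(1) p]] by metis
  have \<sigma>: "?\<sigma> = ?s * sqrt (det ?M)" by (simp add: volume_density_def chart_inv[OF c(1) p])
  have detA: "det A \<noteq> 0" using A(2) by auto
  have detM: "det (?G (fst (fst ?z))) \<noteq> 0" unfolding z using det_metric_matrix[OF c(1) p] by simp
  note su = split_unsplit[of ?G ?z, OF detM]
  have dif: "?G differentiable (at (fst (fst ?z)))" unfolding z by (rule differentiable_metric_matrix[OF c(1) p])
  \<comment> \<open>Composed so that \<open>unsplit\<close> undoes the \<open>split\<close> inside
    \<open>phi_coord\<close>; the frame \<open>A\<close> then normalises the metric to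
    \<open>mat 1\<close> and the density to 1, and the standard form on \<open>split_R7\<close>
    remains.\<close>
  define f where "f u = unsplit ?G ?z (split_frame A (split_R7 u))" for u
  define L where "L u = coord_vector total_space (bundle_chart c) P (f u)" for u
  have "bij (split_frame A)"
    by (rule o_bij[of "split_frame (matrix_inv A)"])
      (simp_all add: fun_eq_iff split_frame_def matrix_inv_mult_eq[OF detA])
  moreover have "bij (unsplit ?G ?z)"
    by (rule o_bij[of "split ?G ?z"]) (simp_all add: fun_eq_iff su)
  ultimately have bij: "bij f"
    using bij_comp[OF bij_comp[OF bij_split_R7, of "split_frame A"], of "unsplit ?G ?z"] unfolding f_def by (simp add: o_def)
  have "linear (split_frame A)"
    by (rule linearI) (simp_all add: split_frame_def matrix_vector_right_distrib matrix_vector_mult_scaleR)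
  then have lin: "linear f"
    using linear_compose[OF linear_compose[OF linear_split_R7, of "split_frame A"] linear_split(2)[OF dif]]
    unfolding f_def by (simp add: o_def)
  have bijC: "bij_betw (coord_vector total_space (bundle_chart c) P) UNIV (tangent_space total_space P)"
    by (rule bij_betw_byWitness[of _ "\<lambda>v. v (bundle_chart c)"])
      (use coord_vector_self[OF bundle_at C] tangent_vector_eq_coord_vector[OF bundle_at _ C]
        coord_vector_in_tangent_space[OF bundle_at C] in auto)
  have "tangent_iso total_space P L"
    unfolding tangent_iso_def
  proof (intro conjI allI)
    show "bij_betw L UNIV (tangent_space total_space P)"
      using bij_betw_trans[OF bij bijC] unfolding L_def by (simp add: o_def)
    show "L (u + v) = tangent_add (L u) (L v)" for u v
      unfolding L_def linear_add[OF lin] by (rule coord_vector_add[OF bundle_at C])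
    show "L (r *\<^sub>R u) = tangent_scale r (L u)" for r u
      unfolding L_def linear_scale[OF lin] by (rule coord_vector_scale[OF bundle_at C])
  qed
  moreover have "phi P (L u) (L v) (L w) = phi0 u v w" for u v w
  proof -
    have "phi P (L u) (L v) (L w) = phi_coord c ?z (f u) (f v) (f w)"
      unfolding L_def
      by (simp only: phi_eq[OF c] coord_vector_in_tangent_space[OF bundle_at C] coord_vector_self[OF bundle_at C])
    also have "\<dots> = g2_form (transpose A ** ?M ** A) (?\<sigma> * det A) (split_R7 u) (split_R7 v) (split_R7 w)"
      unfolding phi_coord_def f_def su g2_form_frame z ..
    also have "\<dots> = phi0 u v w"
      unfolding \<sigma> A g2_form_standard ..
    finally show ?thesis .
  qed
  ultimately show ?thesis by blast
qed

lemma has_G2_structure_total_space: "has_G2_structure total_space"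
  unfolding has_G2_structure_def
  using smooth_manifold_bundle three_form_phi phi_standard by (intro conjI exI[of _ phi]) auto

end

theorem theorem3p1:
  fixes X :: "('a, real ^ 3) manifold"
    and Q :: "('a, real ^ 3) chart set"
    and g :: "'a \<Rightarrow> ('a, real ^ 3) tangent \<Rightarrow> ('a, real ^ 3) tangent \<Rightarrow> real"
  assumes "smooth_manifold X"
    and "orientation X Q"
    and "riemannian_metric X g"
  shows "has_G2_structure
           (product_manifold (cotangent_bundle X) (euclidean_manifold :: (real, real) manifold))"
proof -
  interpret oriented_riemannian_3_manifold X Q g
    using assms by unfold_locales
  show ?thesis by (rule has_G2_structure_total_space)
qed

end
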